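(* The function $p\mapsto C(p)$ is analytic on $(0,1]$.
   Context: For $p\in(0,1]$, the Barak-Erdős graph $\vec G(\mathbb Z,p)$ is the random directed graph on $\mathbb Z$ in which, for each pair $i<j$, there is an edge directed from $i$ to $j$ with probability $p$, independently over pairs. Let $L_n$ be the maximal length (number of edges) of all directed paths in $\vec G(\mathbb Z,p)$ with endpoints in $\{1,\ldots,n\}$. It is known that $L_n/n$ converges a.s. to a deterministic constant; $C(p)$ denotes this constant. Analytic on $(0,1]$ means that for each $p_0\in(0,1]$ the function $C$ coincides on $(0,1]\cap(p_0-\varepsilon,p_0+\varepsilon)$, for some $\varepsilon>0$, with a convergent power series in $p-p_0$. *)

theory Defs
  imports "HOL-Probability.Probability"
begin

text \<open>A configuration assigns to each pair \<open>(i, j)\<close> with \<open>i < j\<close> whether the edge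
  from \<open>i\<close> to \<open>j\<close> is present; under the product measure the pairs are independent.\<close>

definition barak_erdos :: "real \<Rightarrow> (int \<times> int \<Rightarrow> bool) measure" where
  "barak_erdos p = (\<Pi>\<^sub>M ij\<in>{(i, j). i < j}. measure_pmf (bernoulli_pmf p))"

definition edge_set :: "(int \<times> int \<Rightarrow> bool) \<Rightarrow> (int \<times> int) set" where
  "edge_set \<omega> = {(i, j). i < j \<and> \<omega> (i, j)}"

text \<open>A directed path is the list of its vertices, so a path \<open>xs\<close> has \<open>length xs - 1\<close> edges;
  a single vertex is a path of length 0.\<close>

definition directed_path :: "('a \<times> 'a) set \<Rightarrow> 'a list \<Rightarrow> bool" where
  "directed_path E xs \<longleftrightarrow>
     xs \<noteq> [] \<and> distinct xs \<and> successively (\<lambda>u v. (u, v) \<in> E) xs"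

text \<open>All edges increase, so a path with both endpoints in \<open>{1..n}\<close> stays in \<open>{1..n}\<close>; hence for
  \<open>n \<ge> 1\<close> the maximum is over a finite nonempty set. The value at \<open>n = 0\<close> is irrelevant.\<close>

definition longest_path :: "nat \<Rightarrow> (int \<times> int \<Rightarrow> bool) \<Rightarrow> nat" where
  "longest_path n \<omega> =
     Max {length xs - 1 |xs. directed_path (edge_set \<omega>) xs \<and>
            hd xs \<in> {1..int n} \<and> last xs \<in> {1..int n}}"

definition growth_rate :: "real \<Rightarrow> real" where
  "growth_rate p =
     (THE c. AE \<omega> in barak_erdos p. (\<lambda>n. real (longest_path n \<omega>) / real n) \<longlonglongrightarrow> c)"

text \<open>\<open>S\<close> need not be open: at a boundary point, such as 1 in \<open>(0, 1]\<close>, the power series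
  converges on a full neighbourhood but is compared with \<open>f\<close> only on \<open>S\<close>.\<close>

definition real_analytic_on :: "(real \<Rightarrow> real) \<Rightarrow> real set \<Rightarrow> bool" where
  "real_analytic_on f S \<longleftrightarrow>
     (\<forall>x0\<in>S. \<exists>\<epsilon>>0. \<exists>a :: nat \<Rightarrow> real.
        (\<forall>x\<in>{x0 - \<epsilon><..<x0 + \<epsilon>}. summable (\<lambda>n. a n * (x - x0) ^ n)) \<and>
        (\<forall>x\<in>S \<inter> {x0 - \<epsilon><..<x0 + \<epsilon>}. f x = (\<Sum>n. a n * (x - x0) ^ n)))"

end

theory Submission
  imports
    Defs
    "HOL-Complex_Analysis.Complex_Analysis"
    "HOL-Library.Discrete_Functions"
    "HOL-Real_Asymp.Real_Asymp"
begin

text \<open>Reveal the vertices one by one and order the old ones by the length of the longest path ending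
  there. The label of a new vertex is one more than that of the best vertex it is connected to, whose
  rank is geometric with parameter \<open>p\<close>. So the maximal length is the front of an infinite bin model
  driven by independent geometric letters. Its increments have a renewal structure: after a letter 1
  whose successors never reach back beyond it, the increments forget everything before. Words of
  length \<open>n\<close> without such a renewal have probability \<open>O(r ^ n)\<close> with \<open>r < 1\<close>, locally uniformly in \<open>p\<close>.

  For complex \<open>z\<close> near \<open>p\<close>, replacing the weights \<open>p (1 - p) ^ (k - 1)\<close> by \<open>z (1 - z) ^ (k - 1)\<close>
  costs only a factor \<open>M ^ n\<close> with \<open>M = \<bar>z\<bar> / (1 - \<bar>1 - z\<bar>)\<close> close to 1. Hence the mean increments, which
  are polynomials in \<open>z\<close>, converge uniformly near \<open>p\<close>, and their limit is holomorphic. The same decay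
  makes the covariances of the increments summable, so the variance of the front is \<open>O(n)\<close>, which
  yields almost sure convergence along the squares and then, by monotonicity, along all \<open>n\<close>. This
  identifies the limit of the means with the growth rate.\<close>

section \<open>Weighted sums over words and the infinite bin model\<close>

text \<open>For probability weights this is the expectation of \<open>g\<close> over
  \<open>n\<close> independent letters. The weights lie in any commutative ring, so the same sums
  can be evaluated at a complex parameter.\<close>

primrec wsum :: "nat set \<Rightarrow> (nat \<Rightarrow> 'a) \<Rightarrow> nat \<Rightarrow> (nat list \<Rightarrow> 'a) \<Rightarrow> 'a::comm_ring_1" where
  "wsum K w 0 g = g []"
| "wsum K w (Suc n) g = (\<Sum>k\<in>K. w k * wsum K w n (\<lambda>xs. g (k # xs)))"

lemma wsum_cong:
  assumes "\<And>xs. length xs = n \<Longrightarrow> set xs \<subseteq> K \<Longrightarrow> g xs = h xs"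
  shows "wsum K w n g = wsum K w n h"
  using assms
proof (induction n arbitrary: g h)
  case (Suc n)
  have "wsum K w n (\<lambda>xs. g (k # xs)) = wsum K w n (\<lambda>xs. h (k # xs))" if "k \<in> K" for k
    by (rule Suc.IH) (use Suc.prems that in auto)
  then show ?case by (simp cong: sum.cong)
qed simp

lemma wsum_add: "wsum K w n (\<lambda>xs. g xs + h xs) = wsum K w n g + wsum K w n h"
  by (induction n arbitrary: g h) (simp_all add: distrib_left sum.distrib)

lemma wsum_cmult: "wsum K w n (\<lambda>xs. c * g xs) = c * wsum K w n g"
  by (induction n arbitrary: g) (simp_all add: sum_distrib_left mult.left_commute)

lemma wsum_diff: "wsum K w n (\<lambda>xs. g xs - h xs) = wsum K w n g - wsum K w n h"
  by (induction n arbitrary: g h) (simp_all add: right_diff_distrib sum_subtractf)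

lemma wsum_zero [simp]: "wsum K w n (\<lambda>xs. 0) = 0"
  by (induction n) simp_all

lemma wsum_sum: "wsum K w n (\<lambda>xs. \<Sum>i\<in>I. g i xs) = (\<Sum>i\<in>I. wsum K w n (g i))"
  by (induction I rule: infinite_finite_induct) (simp_all add: wsum_add)

lemma wsum_append:
  "wsum K w (m + n) g = wsum K w m (\<lambda>xs. wsum K w n (\<lambda>ys. g (xs @ ys)))"
  by (induction m arbitrary: g) simp_all

lemma wsum_snoc:
  "wsum K w (Suc n) g = wsum K w n (\<lambda>xs. \<Sum>k\<in>K. w k * g (xs @ [k]))"
  using wsum_append[of K w n 1 g] by simp

text \<open>Independence of disjoint blocks of letters as an algebraic identity, which therefore
  survives at complex weights.\<close>

lemma wsum_take_drop:
  "wsum K w (m + n) (\<lambda>xs. g (take m xs) * h (drop m xs)) = wsum K w m g * wsum K w n h"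
proof -
  have "wsum K w (m + n) (\<lambda>xs. g (take m xs) * h (drop m xs)) =
      wsum K w m (\<lambda>xs. wsum K w n (\<lambda>ys. g (take m (xs @ ys)) * h (drop m (xs @ ys))))"
    by (rule wsum_append)
  also have "\<dots> = wsum K w m (\<lambda>xs. g xs * wsum K w n h)"
    by (rule wsum_cong) (simp add: wsum_cmult)
  also have "\<dots> = wsum K w m g * wsum K w n h"
    using wsum_cmult[of K w m "wsum K w n h" g] by (simp add: mult.commute)
  finally show ?thesis .
qed

lemma wsum_const:
  assumes "sum w K = 1"
  shows "wsum K w n (\<lambda>_. c) = c"
  using assms by (induction n) (simp_all flip: sum_distrib_right)

lemma wsum_take:
  assumes "sum w K = 1"
  shows "wsum K w (m + n) (\<lambda>xs. g (take m xs)) = wsum K w m g"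
  using wsum_take_drop[of K w m n g "\<lambda>_. 1"] wsum_const[OF assms, of n 1] by simp

lemma wsum_drop:
  assumes "sum w K = 1"
  shows "wsum K w (m + n) (\<lambda>xs. g (drop m xs)) = wsum K w n g"
  using wsum_take_drop[of K w m n "\<lambda>_. 1" g] wsum_const[OF assms, of m 1] by simp

lemma wsum_mono:
  fixes w :: "nat \<Rightarrow> real"
  assumes "\<And>k. k \<in> K \<Longrightarrow> 0 \<le> w k"
    and "\<And>xs. length xs = n \<Longrightarrow> set xs \<subseteq> K \<Longrightarrow> g xs \<le> h xs"
  shows "wsum K w n g \<le> wsum K w n h"
  using assms(2)
proof (induction n arbitrary: g h)
  case (Suc n)
  have "wsum K w n (\<lambda>xs. g (k # xs)) \<le> wsum K w n (\<lambda>xs. h (k # xs))" if "k \<in> K" for k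
    by (rule Suc.IH) (use Suc.prems that in auto)
  then show ?case using assms(1) by (auto intro!: sum_mono mult_left_mono)
qed simp

lemma wsum_nonneg:
  fixes w :: "nat \<Rightarrow> real"
  assumes "\<And>k. k \<in> K \<Longrightarrow> 0 \<le> w k" and "\<And>xs. 0 \<le> g xs"
  shows "0 \<le> wsum K w n g"
  using wsum_mono[of K w n "\<lambda>_. 0" g] assms by simp

lemma norm_wsum_le:
  fixes w :: "nat \<Rightarrow> 'a::{real_normed_algebra_1,comm_ring_1}"
  shows "norm (wsum K w n g) \<le> wsum K (\<lambda>k. norm (w k)) n (\<lambda>xs. norm (g xs))"
proof (induction n arbitrary: g)
  case (Suc n)
  show ?case unfolding wsum.simps
    by (intro order_trans[OF norm_sum] sum_mono order_trans[OF norm_mult_ineq] mult_left_mono Suc) simp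
qed simp

text \<open>Each letter costs a factor \<open>M\<close>. Together with \<open>norm_wsum_le\<close>
  this transfers bounds from probability weights to complex ones; the loss \<open>M ^ n\<close> has
  to be absorbed by exponential decay.\<close>

lemma wsum_scale_le:
  fixes w w' :: "nat \<Rightarrow> real"
  assumes "\<And>k. k \<in> K \<Longrightarrow> 0 \<le> w k" "\<And>k. k \<in> K \<Longrightarrow> w k \<le> M * w' k"
    and "\<And>xs. 0 \<le> g xs"
  shows "wsum K w n g \<le> M ^ n * wsum K w' n g"
  using assms(3)
proof (induction n arbitrary: g)
  case (Suc n)
  have "w k * wsum K w n (\<lambda>xs. g (k # xs)) \<le> (M * w' k) * (M ^ n * wsum K w' n (\<lambda>xs. g (k # xs)))"
    if "k \<in> K" for k
    using that assms(1)[OF that] assms(2)[OF that] Suc.prems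
    by (intro mult_mono Suc.IH wsum_nonneg) (auto intro: assms(1))
  then show ?case
    by (auto simp: sum_distrib_left mult_ac intro!: sum_mono)
qed simp

text \<open>The infinite bin model: \<open>c v\<close> counts the balls in bins with index greater than \<open>v\<close>, and
  bin 0 holds infinitely many balls. A letter \<open>k\<close> selects the \<open>k\<close>-th ball from the front and
  adds a ball to the next bin.\<close>
definition ibm_step :: "nat \<Rightarrow> (nat \<Rightarrow> nat) \<Rightarrow> nat \<Rightarrow> nat" where
  "ibm_step k c = (\<lambda>v. c v + (case v of 0 \<Rightarrow> 1 | Suc u \<Rightarrow> of_bool (k \<le> c u)))"

definition ibm_run :: "nat list \<Rightarrow> nat \<Rightarrow> nat" where
  "ibm_run xs = fold ibm_step xs (\<lambda>_. 0)"

text \<open>Since \<open>c v\<close> counts the balls beyond bin \<open>v\<close>, the least zero is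
  the index of the last occupied bin.\<close>

definition front :: "(nat \<Rightarrow> nat) \<Rightarrow> nat" where
  "front c = (LEAST v. c v = 0)"

definition front_word :: "nat list \<Rightarrow> nat" where
  "front_word xs = front (ibm_run xs)"

definition bin_config :: "(nat \<Rightarrow> nat) \<Rightarrow> bool" where
  "bin_config c \<longleftrightarrow> antimono c \<and> (\<exists>v. c v = 0)"

lemma ibm_step_0 [simp]: "ibm_step k c 0 = Suc (c 0)"
  by (simp add: ibm_step_def)

lemma ibm_step_Suc [simp]: "ibm_step k c (Suc v) = c (Suc v) + of_bool (k \<le> c v)"
  by (simp add: ibm_step_def)

lemma ibm_run_Nil [simp]: "ibm_run [] = (\<lambda>_. 0)"
  by (simp add: ibm_run_def)

lemma ibm_run_snoc [simp]: "ibm_run (xs @ [k]) = ibm_step k (ibm_run xs)"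
  by (simp add: ibm_run_def)

lemma bin_config_pos_iff:
  assumes "bin_config c"
  shows "0 < c v \<longleftrightarrow> v < front c"
proof -
  have "c (front c) = 0"
    unfolding front_def using assms by (auto simp: bin_config_def intro: LeastI)
  moreover have "c v > 0" if "v < front c"
    using that not_less_Least unfolding front_def by blast
  ultimately show ?thesis
    using assms unfolding bin_config_def by (metis antimonoD le_zero_eq not_le not_less_zero)
qed

lemma front_eqI:
  assumes "\<And>v. 0 < c v \<longleftrightarrow> v < m"
  shows "front c = m"
  unfolding front_def
proof (rule Least_equality)
  show "c m = 0" using assms[of m] by simp
  show "m \<le> y" if "c y = 0" for y
    using that assms[of y] by simp
qed

lemma bin_config_step:
  assumes "bin_config c" "1 \<le> k"
  shows "bin_config (ibm_step k c)"
proof -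
  have a: "c (Suc v) \<le> c v" for v
    using assms(1) by (auto simp: bin_config_def intro: antimonoD)
  have "ibm_step k c (Suc v) \<le> ibm_step k c v" for v
  proof (cases v)
    case (Suc u)
    then show ?thesis using a[of v] a[of u] by auto
  qed (use a[of v] in simp)
  moreover have "ibm_step k c (Suc (front c)) = 0"
    using bin_config_pos_iff[OF assms(1), of "Suc (front c)"]
      bin_config_pos_iff[OF assms(1), of "front c"] assms(2) by simp
  ultimately show ?thesis
    unfolding bin_config_def antimono_def by (metis lift_Suc_antimono_le)
qed

lemma bin_config_run: "set xs \<subseteq> {1..} \<Longrightarrow> bin_config (ibm_run xs)"
proof (induction xs rule: rev_induct)
  case Nil
  then show ?case by (simp add: bin_config_def antimono_def)
qed (simp add: bin_config_step)

text \<open>The front advances exactly when the selected ball lies in the front bin, which holds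
  \<open>c (front c - 1)\<close> balls, or infinitely many if it is bin 0.\<close>

lemma front_step:
  assumes "bin_config c" "1 \<le> k"
  shows "front (ibm_step k c) = front c + of_bool (front c = 0 \<or> k \<le> c (front c - 1))"
proof (rule front_eqI)
  fix v
  note pos = bin_config_pos_iff[OF assms(1)]
  show "0 < ibm_step k c v \<longleftrightarrow> v < front c + of_bool (front c = 0 \<or> k \<le> c (front c - 1))"
  proof (cases v)
    case 0
    then show ?thesis by auto
  next
    case (Suc u)
    show ?thesis
    proof (cases "Suc u" "front c" rule: linorder_cases)
      case less
      then show ?thesis using pos[of "Suc u"] Suc by simp
    next
      case equal
      then show ?thesis using pos[of "Suc u"] Suc by (auto simp flip: equal)
    next
      case greater
      then have "c u = 0" "c (Suc u) = 0" using pos[of u] pos[of "Suc u"] by auto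
      then show ?thesis using greater Suc assms(2) by auto
    qed
  qed
qed

lemma front_word_Nil [simp]: "front_word [] = 0"
  by (simp add: front_word_def front_def)

section \<open>Increments of the front and renewals\<close>

text \<open>For nonempty words over the positive integers this is 0 or 1, with no truncation.\<close>
definition incr :: "nat list \<Rightarrow> nat" where
  "incr xs = front_word xs - front_word (butlast xs)"

lemma front_word_snoc:
  assumes "set (xs @ [k]) \<subseteq> {1..}"
  shows "front_word (xs @ [k]) = front_word xs + incr (xs @ [k])" "incr (xs @ [k]) \<le> 1"
  using front_step[OF bin_config_run, of xs k] assms
  by (auto simp: front_word_def incr_def)

lemma incr_le_1:
  assumes "set xs \<subseteq> {1..}"
  shows "incr xs \<le> 1"
  using front_word_snoc(2)[of "butlast xs" "last xs"] assms
  by (cases "xs = []") (auto simp: incr_def)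

lemma front_word_sum:
  assumes "set xs \<subseteq> {1..}"
  shows "front_word xs = (\<Sum>i=1..length xs. incr (take i xs))"
  using assms
proof (induction xs rule: rev_induct)
  case (snoc k xs)
  then show ?case using front_word_snoc(1)[of xs k]
    by (simp add: atLeastAtMostSuc_conv)
qed simp

text \<open>When \<open>ys ! i\<close> is read, exactly \<open>Suc i\<close> balls have been added
  from the marked letter 1 on; the bound keeps the selection among them.\<close>

definition renewal :: "nat list \<Rightarrow> bool" where
  "renewal vs \<longleftrightarrow> (\<exists>as ys. vs = as @ 1 # ys \<and> (\<forall>i<length ys. ys ! i \<le> Suc i))"

text \<open>After a letter 1 the newest ball is alone in the front bin; as long as the \<open>i\<close>-th letter
  after it is at most \<open>i\<close>, only balls added since then are selected, so the configuration beyond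
  that bin evolves independently of the past.\<close>
lemma ibm_run_renewal:
  assumes "set us \<subseteq> {1..}" "set ys \<subseteq> {1..}" "\<forall>i<length ys. ys ! i \<le> Suc i"
  shows "ibm_run (us @ 1 # ys) (front_word us + v) = ibm_run (1 # ys) v"
    and "ibm_run (1 # ys) 0 = Suc (length ys)"
proof -
  have "(\<forall>v. ibm_run (us @ 1 # ys) (front_word us + v) = ibm_run (1 # ys) v) \<and>
      ibm_run (1 # ys) 0 = Suc (length ys)"
    using assms(2,3)
  proof (induction ys rule: rev_induct)
    case Nil
    note pos = bin_config_pos_iff[OF bin_config_run[OF assms(1)], folded front_word_def]
    have 1: "ibm_run [1] = ibm_step 1 (\<lambda>_. 0)" using ibm_run_snoc[of "[]" 1] by simp
    \<comment> \<open>The new ball opens the bin after the old front, beyond which there was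
      nothing, just as in a run from the empty configuration.\<close>
    have st: "ibm_step 1 (ibm_run us) (front_word us + v) = ibm_step 1 (\<lambda>_. 0) v" for v
    proof (cases v)
      case 0
      show ?thesis
      proof (cases "front_word us")
        case 0
        then show ?thesis using pos[of 0] \<open>v = 0\<close> by simp
      next
        case (Suc u)
        then show ?thesis using pos[of u] pos[of "Suc u"] \<open>v = 0\<close> by simp
      qed
    next
      case (Suc u)
      then show ?thesis using pos[of "front_word us + u"] pos[of "Suc (front_word us + u)"] by simp
    qed
    show ?case by (simp only: 1 ibm_run_snoc st ibm_step_0 list.size simp_thms)
  next
    case (snoc k ys)
    have "\<forall>i<length ys. ys ! i \<le> Suc i"
    proof (intro allI impI)
      show "ys ! i \<le> Suc i" if "i < length ys" for i
        using snoc.prems(2)[rule_format, of i] that by (simp add: nth_append)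
    qed
    with snoc have IH: "\<And>v. ibm_run (us @ 1 # ys) (front_word us + v) = ibm_run (1 # ys) v"
      "ibm_run (1 # ys) 0 = Suc (length ys)"
      by simp_all
    have k: "k \<le> Suc (length ys)"
      using snoc.prems(2)[rule_format, of "length ys"] by simp
    have bc: "bin_config (ibm_run (us @ 1 # ys))"
      using snoc.prems(1) assms(1) by (intro bin_config_run) auto
    have run: "ibm_run (us @ 1 # ys @ [k]) = ibm_step k (ibm_run (us @ 1 # ys))"
      "ibm_run (1 # ys @ [k]) = ibm_step k (ibm_run (1 # ys))"
      using ibm_run_snoc[of "us @ 1 # ys" k] ibm_run_snoc[of "1 # ys" k] by simp_all
    have "ibm_step k (ibm_run (us @ 1 # ys)) (front_word us + v) = ibm_step k (ibm_run (1 # ys)) v" for v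
    proof (cases v)
      case 0
      show ?thesis
      proof (cases "front_word us")
        case 0
        then show ?thesis using IH(1)[of 0] \<open>v = 0\<close> by simp
      next
        case (Suc u)
        \<comment> \<open>\<open>Suc (length ys)\<close> balls lie beyond the old front and
          \<open>k\<close> is at most that, so by monotonicity the new ball also lands beyond it, as
          the fresh run prescribes at index 0.\<close>
        have "ibm_run (us @ 1 # ys) (Suc u) \<le> ibm_run (us @ 1 # ys) u"
          using bc by (auto simp: bin_config_def intro: antimonoD)
        then show ?thesis using IH(1)[of 0] IH(2) k Suc \<open>v = 0\<close> by simp
      qed
    next
      case (Suc u)
      then show ?thesis using IH(1)[of u] IH(1)[of "Suc u"] by simp
    qed
    then show ?case using IH(2) by (simp add: run del: One_nat_def)
  qed
  then show "ibm_run (us @ 1 # ys) (front_word us + v) = ibm_run (1 # ys) v"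
    "ibm_run (1 # ys) 0 = Suc (length ys)" by auto
qed

text \<open>Beyond the old front the counts agree with those of the run of \<open>1 # ys\<close>,
  and at the old front they are still positive, so the fronts add.\<close>

lemma front_word_renewal:
  assumes "set us \<subseteq> {1..}" "set ys \<subseteq> {1..}" "\<forall>i<length ys. ys ! i \<le> Suc i"
  shows "front_word (us @ 1 # ys) = front_word us + front_word (1 # ys)"
  unfolding front_word_def[of "us @ 1 # ys"]
proof (rule front_eqI)
  fix v
  note ren = ibm_run_renewal[OF assms]
  have bc: "bin_config (ibm_run (us @ 1 # ys))" "bin_config (ibm_run (1 # ys))"
    using assms by (auto intro!: bin_config_run)
  show "0 < ibm_run (us @ 1 # ys) v \<longleftrightarrow> v < front_word us + front_word (1 # ys)"
  proof (cases "v < front_word us")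
    case True
    have "ibm_run (us @ 1 # ys) (front_word us) \<le> ibm_run (us @ 1 # ys) v"
      using True bc by (auto simp: bin_config_def intro: antimonoD)
    then show ?thesis using ren(1)[of 0] ren(2) True by simp
  next
    case False
    then obtain u where "v = front_word us + u" by (metis le_Suc_ex not_less)
    then show ?thesis using ren(1)[of u] bin_config_pos_iff[OF bc(2), of u]
      by (simp add: front_word_def)
  qed
qed

text \<open>The word and the word without its last letter share the renewal, so the front of the
  past cancels in the difference. If the marked 1 is itself the last letter, additivity alone gives
  the increment of the one-letter word.\<close>

lemma incr_renewal:
  assumes "renewal vs" "set us \<subseteq> {1..}" "set vs \<subseteq> {1..}"
  shows "incr (us @ vs) = incr vs"
proof -
  obtain as ys where vs: "vs = as @ 1 # ys" and ys: "\<forall>i<length ys. ys ! i \<le> Suc i"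
    using assms(1) by (auto simp: renewal_def)
  have "incr (bs @ 1 # ys) = incr (1 # ys)" if bs: "set bs \<subseteq> {1..}" for bs
  proof (cases "ys = []")
    case True
    then show ?thesis
      using front_word_renewal[of bs "[]"] bs by (simp add: incr_def)
  next
    case False
    have "\<forall>i<length (butlast ys). butlast ys ! i \<le> Suc i" "set (butlast ys) \<subseteq> {1..}"
      using ys assms(3) vs by (auto simp: nth_butlast dest: in_set_butlastD)
    then have "front_word (bs @ 1 # butlast ys) = front_word bs + front_word (1 # butlast ys)"
      using bs by (intro front_word_renewal)
    moreover have "front_word (bs @ 1 # ys) = front_word bs + front_word (1 # ys)"
      using bs ys assms(3) vs by (intro front_word_renewal) auto
    ultimately show ?thesis using False by (simp add: incr_def butlast_append)
  qed
  from this[of "us @ as"] this[of as] show ?thesis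
    using assms(2,3) vs by simp
qed

section \<open>Decay of the weight of words without a renewal\<close>

text \<open>The geometric distribution with parameter \<open>z\<close>, with the mass of \<open>{N..}\<close> lumped at \<open>N\<close>.\<close>
definition geo_weight :: "'a::comm_ring_1 \<Rightarrow> nat \<Rightarrow> nat \<Rightarrow> 'a" where
  "geo_weight z N k = (if k < N then z * (1 - z) ^ (k - 1) else (1 - z) ^ (N - 1))"

lemma sum_geo_weight_tail:
  assumes "a < N"
  shows "(\<Sum>k=Suc a..N. geo_weight z N k) = (1 - z) ^ a"
proof -
  have "a \<le> N - 1" using assms by simp
  then show ?thesis
  proof (induction a rule: inc_induct)
    case base
    then show ?case using assms by (simp add: geo_weight_def)
  next
    case (step a)
    then have "(\<Sum>k=Suc a..N. geo_weight z N k) = geo_weight z N (Suc a) + (\<Sum>k=Suc (Suc a)..N. geo_weight z N k)"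
      by (intro sum.atLeast_Suc_atMost) simp
    then show ?case using step by (simp add: geo_weight_def algebra_simps)
  qed
qed

lemma sum_geo_weight: "1 \<le> N \<Longrightarrow> (\<Sum>k=1..N. geo_weight z N k) = 1"
  using sum_geo_weight_tail[of 0 N z] by simp

lemma sum_geo_weight_le:
  assumes "a < N"
  shows "(\<Sum>k=1..N. geo_weight z N k * of_bool (k \<le> a)) = 1 - (1 - z) ^ a"
proof -
  have "(\<Sum>k=1..N. geo_weight z N k) =
      (\<Sum>k=1..N. geo_weight z N k * of_bool (k \<le> a)) + (\<Sum>k=1..N. geo_weight z N k * of_bool (\<not> k \<le> a))"
    by (subst sum.distrib[symmetric], rule sum.cong) auto
  moreover have "(\<Sum>k=1..N. geo_weight z N k * of_bool (\<not> k \<le> a)) = (\<Sum>k=Suc a..N. geo_weight z N k)"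
    by (rule sum.mono_neutral_cong_right) auto
  ultimately show ?thesis using assms sum_geo_weight_tail[of a N z] sum_geo_weight[of N z] by (simp add: algebra_simps)
qed

lemma geo_weight_nonneg:
  fixes p :: real
  assumes "0 \<le> p" "p \<le> 1"
  shows "0 \<le> geo_weight p N k"
  using assms by (simp add: geo_weight_def)

lemma sum_geo_weight_le_bounds:
  fixes p :: real
  assumes "0 \<le> p" "p \<le> 1" "1 \<le> N"
  shows "1 - (1 - p) ^ a \<le> (\<Sum>k=1..N. geo_weight p N k * of_bool (k \<le> a))"
    and "(\<Sum>k=1..N. geo_weight p N k * of_bool (k \<le> a)) \<le> 1"
proof -
  have "(\<Sum>k=1..N. geo_weight p N k * of_bool (k \<le> a)) \<le> (\<Sum>k=1..N. geo_weight p N k)"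
    using assms by (intro sum_mono) (auto simp: geo_weight_nonneg)
  then show "(\<Sum>k=1..N. geo_weight p N k * of_bool (k \<le> a)) \<le> 1"
    using sum_geo_weight[OF assms(3), of p] by simp
  show "1 - (1 - p) ^ a \<le> (\<Sum>k=1..N. geo_weight p N k * of_bool (k \<le> a))"
  proof (cases "a < N")
    case False
    then have "(\<Sum>k=1..N. geo_weight p N k * of_bool (k \<le> a)) = (\<Sum>k=1..N. geo_weight p N k)"
      by (intro sum.cong) auto
    then show ?thesis using sum_geo_weight[OF assms(3), of p] assms by simp
  next
    case True
    then show ?thesis using sum_geo_weight_le[of a N p] by linarith
  qed
qed

text \<open>Over positive letters: the first letter is 1, and the letter at index
  \<open>i > 0\<close> selects one of the \<open>i\<close> balls added since the word began. A
  nonempty such word renews at its first letter.\<close>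

definition self_contained :: "nat list \<Rightarrow> bool" where
  "self_contained xs \<longleftrightarrow> (\<forall>i<length xs. xs ! i \<le> max 1 i)"

lemma self_contained_snoc:
  "self_contained (xs @ [k]) \<longleftrightarrow> self_contained xs \<and> k \<le> max 1 (length xs)"
  by (auto simp: self_contained_def nth_append less_Suc_eq split: if_splits)

lemma self_contained_imp_renewal:
  assumes "self_contained xs" "xs \<noteq> []" "set xs \<subseteq> {1..}"
  shows "renewal xs"
proof -
  obtain k ys where xs: "xs = k # ys" using assms(2) by (cases xs) auto
  then have "k = 1" using assms by (auto simp: self_contained_def)
  moreover have "\<forall>i<length ys. ys ! i \<le> Suc i"
    using assms(1) xs by (force simp: self_contained_def)
  ultimately show ?thesis unfolding renewal_def xs by (metis append_Nil)
qed

lemma renewal_appendI: "renewal vs \<Longrightarrow> renewal (us @ vs)"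
  unfolding renewal_def by (metis append_assoc)

text \<open>The difference of indicators marks the first length \<open>j\<close> at which the prefix
  stops being self-contained. Such a \<open>j\<close> exists because a self-contained word renews at
  its first letter, and the suffix has no renewal because it would be one of the whole word.\<close>

lemma not_renewal_le_sum:
  assumes "xs \<noteq> []" "set xs \<subseteq> {1..}"
  shows "(of_bool (\<not> renewal xs) :: real) \<le> (\<Sum>j=1..length xs.
      (of_bool (self_contained (take (j - 1) xs)) - of_bool (self_contained (take j xs))) *
      of_bool (\<not> renewal (drop j xs)))"
proof -
  have anti: "self_contained (take j xs) \<Longrightarrow> self_contained (take (j - 1) xs)" for j
    by (auto simp: self_contained_def)
  have nonneg: "0 \<le> (of_bool (self_contained (take (j - 1) xs)) - of_bool (self_contained (take j xs))) *
      (of_bool (\<not> renewal (drop j xs)) :: real)" for j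
    using anti[of j] by auto
  show ?thesis
  proof (cases "renewal xs")
    case False
    have ex: "\<not> self_contained (take (length xs) xs)"
      using False assms self_contained_imp_renewal by auto
    define j where "j = (LEAST j. \<not> self_contained (take j xs))"
    have j: "\<not> self_contained (take j xs)" "j \<le> length xs"
      unfolding j_def using LeastI[of "\<lambda>j. \<not> self_contained (take j xs)", OF ex]
        Least_le[of "\<lambda>j. \<not> self_contained (take j xs)", OF ex] by blast+
    have "j \<noteq> 0" using j(1) by (rule contrapos_nn) (simp add: self_contained_def)
    then have "self_contained (take (j - 1) xs)"
      using not_less_Least[of "j - 1" "\<lambda>j. \<not> self_contained (take j xs)"] by (simp add: j_def)
    moreover have "\<not> renewal (drop j xs)"
      using False renewal_appendI[of "drop j xs" "take j xs"] by auto
    ultimately have "(of_bool (\<not> renewal xs) :: real) \<le> (of_bool (self_contained (take (j - 1) xs)) - of_bool (self_contained (take j xs))) *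
      of_bool (\<not> renewal (drop j xs))" using j False by simp
    also have "\<dots> \<le> (\<Sum>j=1..length xs.
      (of_bool (self_contained (take (j - 1) xs)) - of_bool (self_contained (take j xs))) *
      of_bool (\<not> renewal (drop j xs)))"
      using \<open>j \<noteq> 0\<close> j(2) nonneg by (intro member_le_sum) auto
    finally show ?thesis .
  next
    case True
    then have "(of_bool (\<not> renewal xs) :: real) = 0" by simp
    then show ?thesis using nonneg by (simp only: sum_nonneg)
  qed
qed

text \<open>Being self-contained is a separate condition on each letter, so independence gives a
  product.\<close>

lemma wsum_self_contained:
  "wsum {1..N} (geo_weight p N) n (\<lambda>xs. of_bool (self_contained xs)) =
    (\<Prod>i<n. \<Sum>k=1..N. geo_weight p N k * of_bool (k \<le> max 1 i))"
proof (induction n)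
  case 0
  then show ?case by (simp add: self_contained_def)
next
  case (Suc n)
  have "wsum {1..N} (geo_weight p N) (Suc n) (\<lambda>xs. of_bool (self_contained xs)) =
      wsum {1..N} (geo_weight p N) n (\<lambda>xs. (\<Sum>k=1..N. geo_weight p N k * of_bool (k \<le> max 1 n)) * of_bool (self_contained xs))"
    unfolding wsum_snoc
    by (rule wsum_cong) (auto simp: self_contained_snoc sum_distrib_right intro!: sum.cong)
  then show ?case using Suc by (simp add: wsum_cmult)
qed

text \<open>No factor is 0 and \<open>q ^ i\<close> is summable, so the infinite product is nonzero;
  the partial products decrease to it.\<close>

lemma prod_one_minus_power_lower_bound:
  fixes q :: real
  assumes "0 \<le> q" "q < 1"
  shows "\<exists>c>0. \<forall>n. c \<le> (\<Prod>i<n. 1 - q ^ max 1 i)"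
proof -
  define f where "f i = 1 - q ^ max 1 i" for i
  have pow: "q ^ max 1 i < 1" for i
    using assms power_strict_mono[of q 1 "max 1 i"] by simp
  have "summable (\<lambda>i. norm (f (Suc i) - 1))"
    using summable_mult[OF summable_geometric[of q], of q] assms
    by (simp add: f_def)
  then have "summable (\<lambda>i. norm (f i - 1))"
    by (subst (asm) summable_Suc_iff)
  then have "convergent_prod f"
    using abs_convergent_prod_conv_summable abs_convergent_prod_imp_convergent_prod by blast
  moreover have "f i \<noteq> 0" for i using pow[of i] by (simp add: f_def)
  ultimately obtain L where L: "(\<lambda>n. \<Prod>i\<le>n. f i) \<longlonglongrightarrow> L" "L \<noteq> 0"
    using convergent_prod_iff_nz_lim by blast
  have f01: "0 < f i" "f i \<le> 1" for i using pow[of i] assms by (simp_all add: f_def)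
  have "decseq (\<lambda>n. \<Prod>i\<le>n. f i)"
    using f01 by (intro decseq_SucI) (auto intro!: mult_left_le prod_nonneg simp: less_imp_le)
  then have ge: "L \<le> (\<Prod>i\<le>n. f i)" for n using decseq_ge L(1) by blast
  have "0 \<le> L" using L(1) f01 by (intro LIMSEQ_le_const) (auto intro!: prod_nonneg simp: less_imp_le)
  with L(2) have "0 < L" by simp
  moreover have "L \<le> (\<Prod>i<n. f i)" for n
  proof (cases n)
    case 0
    then show ?thesis using ge[of 0] f01(2)[of 0] by simp
  next
    case (Suc m)
    then show ?thesis using ge[of m] by (simp add: lessThan_Suc_atMost)
  qed
  ultimately show ?thesis unfolding f_def by blast
qed

text \<open>The full series has the closed form \<open>R / (1 - q * R) - 1 / (1 - q)\<close>, which
  tends to 0 as \<open>R\<close> decreases to 1.\<close>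

lemma ex_ratio:
  fixes q c :: real
  assumes "0 \<le> q" "q < 1" "0 < c"
  shows "\<exists>R>1. \<forall>n. (\<Sum>j=1..n. q ^ (j - 1) * (R ^ j - 1)) \<le> c"
proof -
  have "((\<lambda>R. R * (1 / (1 - q * R)) - 1 / (1 - q)) \<longlongrightarrow> 1 * (1 / (1 - q * 1)) - 1 / (1 - q)) (at_right 1)"
    using assms by (intro tendsto_intros) auto
  then have "eventually (\<lambda>R. R * (1 / (1 - q * R)) - 1 / (1 - q) < c) (at_right 1)"
    using assms by (intro order_tendstoD(2)) auto
  moreover have "((\<lambda>R. q * R) \<longlongrightarrow> q * 1) (at_right 1)" by (intro tendsto_intros)
  then have "eventually (\<lambda>R. q * R < 1) (at_right 1)"
    using assms by (intro order_tendstoD(2)) auto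
  moreover have "eventually (\<lambda>R::real. 1 < R) (at_right 1)" by (rule eventually_at_right_less)
  ultimately have "eventually (\<lambda>R. R * (1 / (1 - q * R)) - 1 / (1 - q) < c \<and> q * R < 1 \<and> 1 < R) (at_right 1)"
    by eventually_elim auto
  then obtain R where R: "R * (1 / (1 - q * R)) - 1 / (1 - q) < c" "q * R < 1" "1 < R"
    using eventually_happens[of _ "at_right (1::real)"] by auto
  have "(\<lambda>j. R * (q * R) ^ j - q ^ j) sums (R * (1 / (1 - q * R)) - 1 / (1 - q))"
    using assms R by (intro sums_diff sums_mult geometric_sums) auto
  moreover have eq: "R * (q * R) ^ j - q ^ j = q ^ j * (R ^ Suc j - 1)" for j
    by (simp add: power_mult_distrib algebra_simps)
  ultimately have S: "(\<lambda>j. q ^ j * (R ^ Suc j - 1)) sums (R * (1 / (1 - q * R)) - 1 / (1 - q))" by simp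
  have nonneg: "0 \<le> q ^ j * (R ^ Suc j - 1)" for j
    using assms(1) one_le_power[of R "Suc j"] R(3) by (simp del: power_Suc)
  have "(\<Sum>j=1..n. q ^ (j - 1) * (R ^ j - 1)) \<le> c" for n
  proof -
    have "(\<Sum>j=1..n. q ^ (j - 1) * (R ^ j - 1)) = (\<Sum>j<n. q ^ j * (R ^ Suc j - 1))"
      by (rule sum.reindex_bij_witness[of _ Suc "\<lambda>j. j - 1"]) auto
    also have "\<dots> \<le> suminf (\<lambda>j. q ^ j * (R ^ Suc j - 1))"
      using nonneg sums_summable[OF S] by (intro sum_le_suminf) auto
    also have "\<dots> \<le> c" using R(1) sums_unique[OF S] by simp
    finally show ?thesis .
  qed
  then show ?thesis using R(3) by blast
qed

text \<open>A word without a renewal starts with a minimal prefix that is not self-contained, and the rest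
  has no renewal either. Since the masses \<open>v j\<close> of these prefixes have exponential tails and total
  mass bounded away from 1, the resulting recursion gives exponential decay.\<close>
lemma wsum_not_renewal_le:
  fixes q :: real
  assumes "0 \<le> q" "q < 1"
  shows "\<exists>R>1. \<forall>p N n. 1 - q \<le> p \<longrightarrow> p \<le> 1 \<longrightarrow> 1 \<le> N \<longrightarrow>
    wsum {1..N} (geo_weight p N) n (\<lambda>xs. of_bool (\<not> renewal xs)) \<le> (1 / R) ^ n"
proof -
  obtain c where c: "c > 0" "\<And>n. c \<le> (\<Prod>i<n. 1 - q ^ max 1 i)"
    using prod_one_minus_power_lower_bound[OF assms] by blast
  obtain R where R: "R > 1" "\<And>n. (\<Sum>j=1..n. q ^ (j - 1) * (R ^ j - 1)) \<le> c"
    using ex_ratio[OF assms c(1)] by blast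
  have "wsum {1..N} (geo_weight p N) n (\<lambda>xs. of_bool (\<not> renewal xs)) \<le> (1 / R) ^ n"
    if p: "1 - q \<le> p" "p \<le> 1" "1 \<le> N" for p N n
  proof -
    define s where "s i = (\<Sum>k=1..N. geo_weight p N k * of_bool (k \<le> max 1 i))" for i
    define u where "u n = (\<Prod>i<n. s i)" for n
    define v where "v j = u (j - 1) - u j" for j
    define b where "b n = wsum {1..N} (geo_weight p N) n (\<lambda>xs. of_bool (\<not> renewal xs))" for n
    have p0: "0 \<le> p" using p assms by simp
    have w0: "0 \<le> geo_weight p N k" for k using geo_weight_nonneg p0 p(2) by blast
    have u: "wsum {1..N} (geo_weight p N) n (\<lambda>xs. of_bool (self_contained xs)) = u n" for n
      unfolding u_def s_def by (rule wsum_self_contained)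
    have s_lower: "1 - q ^ max 1 i \<le> s i" for i
    proof -
      have "(1 - p) ^ max 1 i \<le> q ^ max 1 i" using p by (intro power_mono) auto
      then show ?thesis using sum_geo_weight_le_bounds(1)[OF p0 p(2,3), of "max 1 i"] by (simp add: s_def)
    qed
    have s_upper: "s i \<le> 1" for i
      unfolding s_def using sum_geo_weight_le_bounds(2)[OF p0 p(2,3)] by blast
    have qpow: "q ^ k \<le> 1" for k using assms by (simp add: power_le_one)
    have s0: "0 \<le> s i" for i using s_lower[of i] qpow[of "max 1 i"] by linarith
    have u0: "0 \<le> u n" for n unfolding u_def using s0 by (intro prod_nonneg) auto
    have u1: "u n \<le> 1" for n unfolding u_def using s0 s_upper by (intro prod_le_1) auto
    have uc: "c \<le> u n" for n
    proof -
      have "(\<Prod>i<n. 1 - q ^ max 1 i) \<le> u n"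
        unfolding u_def using s_lower qpow by (intro prod_mono) auto
      then show ?thesis using c(2)[of n] by simp
    qed
    have v_Suc: "v (Suc j) = u j * (1 - s j)" for j
      by (simp add: v_def u_def algebra_simps)
    have v0: "0 \<le> v j" if "1 \<le> j" for j
      using that v_Suc[of "j - 1"] u0 s_upper by simp
    \<comment> \<open>A self-contained prefix of length \<open>j - 1\<close> is broken only by a
      letter above \<open>max 1 (j - 1)\<close>.\<close>
    have vq: "v j \<le> q ^ (j - 1)" if j: "1 \<le> j" for j
    proof -
      have "v j \<le> 1 * (1 - s (j - 1))"
        using j v_Suc[of "j - 1"] mult_right_mono[OF u1[of "j - 1"], of "1 - s (j - 1)"] s_upper[of "j - 1"]
        by simp
      also have "\<dots> \<le> q ^ max 1 (j - 1)" using s_lower[of "j - 1"] by simp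
      also have "\<dots> \<le> q ^ (j - 1)" using assms by (intro power_decreasing) auto
      finally show ?thesis .
    qed
    have vsum: "(\<Sum>j=1..n. v j) = 1 - u n" for n
      by (induction n) (simp_all add: v_def u_def atLeastAtMostSuc_conv)
    \<comment> \<open>The masses sum to at most \<open>1 - c\<close>, and \<open>R\<close> was
      chosen so that the weights \<open>R ^ j\<close> add at most \<open>c\<close>.\<close>
    have vR: "(\<Sum>j=1..n. v j * R ^ j) \<le> 1" for n
    proof -
      have "(\<Sum>j=1..n. v j * R ^ j) = (\<Sum>j=1..n. v j) + (\<Sum>j=1..n. v j * (R ^ j - 1))"
        by (simp add: algebra_simps flip: sum.distrib)
      also have "(\<Sum>j=1..n. v j * (R ^ j - 1)) \<le> (\<Sum>j=1..n. q ^ (j - 1) * (R ^ j - 1))"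
        using vq R(1) by (intro sum_mono mult_right_mono) (auto simp: one_le_power)
      finally show ?thesis using vsum[of n] uc[of n] R(2)[of n] by simp
    qed
    have rec: "b n \<le> (\<Sum>j=1..n. v j * b (n - j))" if n: "1 \<le> n" for n
    proof -
      have "b n \<le> wsum {1..N} (geo_weight p N) n (\<lambda>xs. \<Sum>j=1..n.
        (of_bool (self_contained (take (j - 1) xs)) - of_bool (self_contained (take j xs))) *
        of_bool (\<not> renewal (drop j xs)))"
        unfolding b_def
      proof (intro wsum_mono w0)
        fix xs :: "nat list" assume "length xs = n" "set xs \<subseteq> {1..N}"
        then show "(of_bool (\<not> renewal xs) :: real) \<le> (\<Sum>j=1..n.
          (of_bool (self_contained (take (j - 1) xs)) - of_bool (self_contained (take j xs))) *
          of_bool (\<not> renewal (drop j xs)))"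
          using not_renewal_le_sum[of xs] n by fastforce
      qed
      also have "\<dots> = (\<Sum>j=1..n. v j * b (n - j))"
        unfolding wsum_sum
      proof (rule sum.cong[OF refl])
        fix j assume j: "j \<in> {1..n}"
        \<comment> \<open>\<open>butlast (take j xs)\<close> stands for
          \<open>take (j - 1) xs\<close>, to exhibit the first factor as a function of
          \<open>take j xs\<close>, as the product rule for blocks requires.\<close>
        have "wsum {1..N} (geo_weight p N) (j + (n - j)) (\<lambda>xs.
          (of_bool (self_contained (butlast (take j xs))) - of_bool (self_contained (take j xs))) *
          of_bool (\<not> renewal (drop j xs))) =
          wsum {1..N} (geo_weight p N) j (\<lambda>xs. of_bool (self_contained (butlast xs)) - of_bool (self_contained xs)) * b (n - j)"
          unfolding b_def by (rule wsum_take_drop)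
        also have "wsum {1..N} (geo_weight p N) j (\<lambda>xs. of_bool (self_contained (butlast xs)) - of_bool (self_contained xs)) = 
          wsum {1..N} (geo_weight p N) j (\<lambda>xs. of_bool (self_contained (take (j - 1) xs))) - u j"
          unfolding wsum_diff u by (intro arg_cong2[where f = "(-)"] wsum_cong) (auto simp: butlast_conv_take)
        also have "wsum {1..N} (geo_weight p N) j (\<lambda>xs. of_bool (self_contained (take (j - 1) xs))) = u (j - 1)"
          using wsum_take[OF sum_geo_weight[OF p(3)], of p "j - 1" 1 "\<lambda>xs. of_bool (self_contained xs)"] j u
          by (simp del: wsum.simps)
        finally have "wsum {1..N} (geo_weight p N) (j + (n - j)) (\<lambda>xs.
          (of_bool (self_contained (butlast (take j xs))) - of_bool (self_contained (take j xs))) *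
          of_bool (\<not> renewal (drop j xs))) = v j * b (n - j)" by (simp add: v_def)
        moreover have "wsum {1..N} (geo_weight p N) n (\<lambda>xs.
          (of_bool (self_contained (butlast (take j xs))) - of_bool (self_contained (take j xs))) *
          of_bool (\<not> renewal (drop j xs))) = wsum {1..N} (geo_weight p N) n (\<lambda>xs.
          (of_bool (self_contained (take (j - 1) xs)) - of_bool (self_contained (take j xs))) *
          of_bool (\<not> renewal (drop j xs)))"
          using j by (intro wsum_cong) (auto simp: butlast_take)
        ultimately show "wsum {1..N} (geo_weight p N) n (\<lambda>xs.
          (of_bool (self_contained (take (j - 1) xs)) - of_bool (self_contained (take j xs))) *
          of_bool (\<not> renewal (drop j xs))) = v j * b (n - j)" using j by simp
      qed
      finally show ?thesis .
    qed
    \<comment> \<open>Inserting the bound for shorter words into the recursion leaves the factor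
      bounded by 1 in \<open>vR\<close>.\<close>
    have "b n \<le> (1 / R) ^ n"
    proof (induction n rule: less_induct)
      case (less n)
      show ?case
      proof (cases "n = 0")
        case True
        then show ?thesis by (simp add: b_def)
      next
        case False
        have "b n \<le> (\<Sum>j=1..n. v j * b (n - j))" using False by (intro rec) simp
        also have "\<dots> \<le> (\<Sum>j=1..n. v j * (1 / R) ^ (n - j))"
          using v0 less by (intro sum_mono mult_left_mono) auto
        also have "\<dots> = (\<Sum>j=1..n. v j * R ^ j) * (1 / R) ^ n"
          unfolding sum_distrib_right using R(1)
          by (intro sum.cong) (auto simp: power_diff field_simps)
        also have "\<dots> \<le> 1 * (1 / R) ^ n" using vR R(1) by (intro mult_right_mono) auto
        finally show ?thesis by simp
      qed
    qed
    then show ?thesis by (simp add: b_def)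
  qed
  then show ?thesis using R(1) by blast
qed

section \<open>Analytic continuation of the mean front\<close>

lemma ibm_run_le_length: "ibm_run xs v \<le> length xs"
proof (induction xs arbitrary: v rule: rev_induct)
  case (snoc k xs)
  show ?case
  proof (cases v)
    case 0
    then show ?thesis using snoc[of 0] by simp
  next
    case (Suc u)
    then show ?thesis using snoc[of "Suc u"] by simp
  qed
qed simp

text \<open>The last weight collects the whole geometric tail, which is invisible to a configuration with
  fewer than \<open>N\<close> balls.\<close>
lemma wsum_ibm_run_truncation_Suc:
  assumes "n < N"
  shows "wsum {1..Suc N} (geo_weight z (Suc N)) n (\<lambda>xs. g (ibm_run xs)) =
    wsum {1..N} (geo_weight z N) n (\<lambda>xs. g (ibm_run xs))"
  using assms
proof (induction n arbitrary: g)
  case (Suc n)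
  define G where "G c = (\<Sum>k=1..N. geo_weight z N k * g (ibm_step k c))" for c
  have *: "(\<Sum>k=1..Suc N. geo_weight z (Suc N) k * g (ibm_step k c)) = G c"
    if c: "\<And>v. c v < N" for c
  proof -
    obtain M where N: "N = Suc M" using Suc.prems by (cases N) auto
    have "ibm_step (Suc N) c = ibm_step N c"
    proof
      show "ibm_step (Suc N) c v = ibm_step N c v" for v
        using c by (cases v) (auto simp: not_le less_SucI)
    qed
    moreover have "(\<Sum>k=1..M. geo_weight z (Suc N) k * g (ibm_step k c)) = (\<Sum>k=1..M. geo_weight z N k * g (ibm_step k c))"
      by (rule sum.cong) (auto simp: geo_weight_def N)
    \<comment> \<open>The weights \<open>z * (1 - z) ^ (N - 1)\<close> of \<open>N\<close> and
      \<open>(1 - z) ^ N\<close> of \<open>Suc N\<close> add up to the lumped weight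
      \<open>(1 - z) ^ (N - 1)\<close>.\<close>
    ultimately show ?thesis
      unfolding G_def by (simp add: N atLeastAtMostSuc_conv geo_weight_def algebra_simps)
  qed
  have run: "ibm_run xs v < N" if "length xs = n" for xs v
    using ibm_run_le_length[of xs v] that Suc.prems by simp
  have "wsum {1..Suc N} (geo_weight z (Suc N)) (Suc n) (\<lambda>xs. g (ibm_run xs)) =
      wsum {1..Suc N} (geo_weight z (Suc N)) n (\<lambda>xs. G (ibm_run xs))"
    unfolding wsum_snoc ibm_run_snoc by (intro wsum_cong * run)
  also have "\<dots> = wsum {1..N} (geo_weight z N) n (\<lambda>xs. G (ibm_run xs))"
    using Suc by simp
  also have "\<dots> = wsum {1..N} (geo_weight z N) (Suc n) (\<lambda>xs. g (ibm_run xs))"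
    unfolding wsum_snoc ibm_run_snoc G_def ..
  finally show ?case .
qed simp

text \<open>The expected front after \<open>n\<close> letters, as a polynomial in \<open>z\<close>.
  Any truncation level above \<open>n\<close> gives the same value.\<close>

definition mean_front :: "'a::comm_ring_1 \<Rightarrow> nat \<Rightarrow> 'a" where
  "mean_front z n = wsum {1..Suc n} (geo_weight z (Suc n)) n (\<lambda>xs. of_nat (front_word xs))"

lemma mean_front_eq:
  assumes "n < N"
  shows "wsum {1..N} (geo_weight z N) n (\<lambda>xs. of_nat (front_word xs)) = mean_front z n"
proof -
  have "Suc n \<le> N" using assms by simp
  then show ?thesis
  proof (induction N rule: dec_induct)
    case base
    then show ?case by (simp only: mean_front_def)
  next
    case (step N)
    then show ?case
      using wsum_ibm_run_truncation_Suc[of n N z "\<lambda>c. of_nat (front c)"]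
      by (simp only: front_word_def)
  qed
qed

lemma mean_front_diff:
  assumes "Suc n < N"
  shows "mean_front z (Suc n) - mean_front z n =
    wsum {1..N} (geo_weight z N) (Suc n) (\<lambda>xs. of_nat (incr xs))"
proof -
  have "mean_front z (Suc n) = wsum {1..N} (geo_weight z N) (Suc n) (\<lambda>xs. of_nat (front_word xs))"
    using assms by (simp only: mean_front_eq)
  also have "\<dots> = wsum {1..N} (geo_weight z N) (Suc n) (\<lambda>xs. of_nat (front_word (take n xs)) + of_nat (incr xs))"
  proof (rule wsum_cong)
    fix xs :: "nat list" assume xs: "length xs = Suc n" "set xs \<subseteq> {1..N}"
    then have "xs = take n xs @ [last xs]"
      by (metis append_butlast_last_id butlast_conv_take diff_Suc_1 list.size(3) nat.distinct(1))
    moreover have "set xs \<subseteq> {1..}" using xs(2) by auto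
    ultimately have "front_word xs = front_word (take n xs) + incr xs"
      using front_word_snoc(1)[of "take n xs" "last xs"] by metis
    then show "of_nat (front_word xs) = of_nat (front_word (take n xs)) + (of_nat (incr xs) :: 'a)"
      by simp
  qed
  also have "\<dots> = mean_front z n + wsum {1..N} (geo_weight z N) (Suc n) (\<lambda>xs. of_nat (incr xs))"
    unfolding wsum_add using assms wsum_take[OF sum_geo_weight, of N z n 1 "\<lambda>xs. of_nat (front_word xs)"]
      mean_front_eq[of n N z] by (simp del: wsum.simps)
  finally show ?thesis by simp
qed

text \<open>The comparison parameter \<open>1 - norm (1 - z)\<close> makes the powers in both
  weights match, leaving the ratio of \<open>norm z\<close> to it. The triangle inequality forces
  \<open>1 \<le> M\<close>, which covers the lumped letter.\<close>

lemma norm_geo_weight_le: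
  fixes z :: complex
  assumes "norm (1 - z) < 1" "norm z \<le> M * (1 - norm (1 - z))"
  shows "norm (geo_weight z N k) \<le> M * geo_weight (1 - norm (1 - z)) N k"
proof -
  have "1 - norm (1 - z) \<le> norm z"
    using norm_triangle_ineq[of z "1 - z"] by simp
  then have "1 * (1 - norm (1 - z)) \<le> M * (1 - norm (1 - z))" using assms(2) by simp
  then have M: "1 \<le> M" using assms(1) by (subst (asm) mult_le_cancel_right) simp
  show ?thesis
  proof (cases "k < N")
    case True
    then show ?thesis
      using mult_right_mono[OF assms(2), of "norm (1 - z) ^ (k - 1)"]
      by (simp add: geo_weight_def norm_mult norm_power mult.assoc)
  next
    case False
    then show ?thesis
      using mult_right_mono[OF M, of "norm (1 - z) ^ (N - 1)"]
      by (simp add: geo_weight_def norm_power)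
  qed
qed

text \<open>Deleting the first letter does not change the law of the rest, so the second difference
  averages \<open>incr xs\<close> minus \<open>incr (drop 1 xs)\<close>, which vanishes if
  \<open>drop 1 xs\<close> has a renewal. The \<open>n + 2\<close> letters cost
  \<open>M ^ (n + 2)\<close> against the decay \<open>(1 / R) ^ (n + 1)\<close>.\<close>

lemma norm_mean_front_second_diff_le:
  fixes z :: complex and M R q :: real
  assumes z: "norm (1 - z) \<le> q" "q < 1" "norm z \<le> M * (1 - norm (1 - z))" and R: "1 < R" "0 \<le> M"
    and bad: "\<And>p N n. 1 - q \<le> p \<Longrightarrow> p \<le> 1 \<Longrightarrow> 1 \<le> N \<Longrightarrow>
      wsum {1..N} (geo_weight p N) n (\<lambda>xs. of_bool (\<not> renewal xs)) \<le> (1 / R) ^ n"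
  shows "norm ((mean_front z (Suc (Suc n)) - mean_front z (Suc n)) - (mean_front z (Suc n) - mean_front z n))
    \<le> M * (M / R) ^ Suc n"
proof -
  \<comment> \<open>One truncation level for both increments: it must exceed
    \<open>n + 2\<close>.\<close>
  define N where "N = n + 3"
  define p where "p = 1 - norm (1 - z)"
  define w where "w = geo_weight z N"
  have sum1: "sum w {1..N} = 1" unfolding w_def by (rule sum_geo_weight) (simp add: N_def)
  have psum1: "sum (geo_weight p N) {1..N} = 1" by (rule sum_geo_weight) (simp add: N_def)
  have "(mean_front z (Suc (Suc n)) - mean_front z (Suc n)) - (mean_front z (Suc n) - mean_front z n) =
      wsum {1..N} w (Suc (Suc n)) (\<lambda>xs. of_nat (incr xs)) - wsum {1..N} w (Suc n) (\<lambda>xs. of_nat (incr xs))"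
    unfolding w_def by (subst (1 2) mean_front_diff[where N = N]) (simp_all add: N_def del: wsum.simps)
  also have "wsum {1..N} w (Suc n) (\<lambda>xs. of_nat (incr xs)) = wsum {1..N} w (Suc (Suc n)) (\<lambda>xs. of_nat (incr (drop 1 xs)))"
    using wsum_drop[OF sum1, of 1 "Suc n" "\<lambda>xs. of_nat (incr xs)"] by (simp del: wsum.simps)
  finally have eq: "(mean_front z (Suc (Suc n)) - mean_front z (Suc n)) - (mean_front z (Suc n) - mean_front z n) =
      wsum {1..N} w (Suc (Suc n)) (\<lambda>xs. of_nat (incr xs) - of_nat (incr (drop 1 xs)))"
    by (simp only: wsum_diff)
  have "norm (wsum {1..N} w (Suc (Suc n)) (\<lambda>xs. of_nat (incr xs) - of_nat (incr (drop 1 xs)))) \<le>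
      wsum {1..N} (\<lambda>k. norm (w k)) (Suc (Suc n)) (\<lambda>xs. norm (of_nat (incr xs) - of_nat (incr (drop 1 xs)) :: complex))"
    by (rule norm_wsum_le)
  also have "\<dots> \<le> wsum {1..N} (\<lambda>k. norm (w k)) (Suc (Suc n)) (\<lambda>xs. of_bool (\<not> renewal (drop 1 xs)))"
  proof (rule wsum_mono)
    fix xs :: "nat list" assume xs: "length xs = Suc (Suc n)" "set xs \<subseteq> {1..N}"
    then have s: "set xs \<subseteq> {1..}" "set (take 1 xs) \<subseteq> {1..}" "set (drop 1 xs) \<subseteq> {1..}"
      by (auto dest: in_set_takeD in_set_dropD)
    have "incr xs = incr (drop 1 xs)" if "renewal (drop 1 xs)"
      using incr_renewal[OF that s(2,3)] by (simp only: append_take_drop_id)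
    moreover have "incr xs = 0 \<or> incr xs = 1" "incr (drop 1 xs) = 0 \<or> incr (drop 1 xs) = 1"
      using incr_le_1[OF s(1)] incr_le_1[OF s(3)] by linarith+
    ultimately show "norm (of_nat (incr xs) - of_nat (incr (drop 1 xs)) :: complex) \<le> of_bool (\<not> renewal (drop 1 xs))"
      by (cases "renewal (drop 1 xs)") auto
  qed simp
  also have "\<dots> \<le> M ^ (Suc (Suc n)) * wsum {1..N} (geo_weight p N) (Suc (Suc n)) (\<lambda>xs. of_bool (\<not> renewal (drop 1 xs)))"
    unfolding w_def p_def by (intro wsum_scale_le norm_geo_weight_le) (use z in auto)
  also have "wsum {1..N} (geo_weight p N) (Suc (Suc n)) (\<lambda>xs. of_bool (\<not> renewal (drop 1 xs))) =
      wsum {1..N} (geo_weight p N) (Suc n) (\<lambda>xs. of_bool (\<not> renewal xs))"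
    using wsum_drop[OF psum1, of 1 "Suc n" "\<lambda>xs. of_bool (\<not> renewal xs)"] by (simp del: wsum.simps)
  also have "M ^ Suc (Suc n) * \<dots> \<le> M ^ Suc (Suc n) * (1 / R) ^ Suc n"
    by (intro mult_left_mono bad) (use z R in \<open>auto simp: p_def N_def\<close>)
  also have "\<dots> = M * (M / R) ^ Suc n" by (simp add: power_divide)
  finally show ?thesis unfolding eq .
qed

section \<open>Holomorphy of the limit of the means\<close>

lemma tendsto_cesaro:
  fixes x :: "nat \<Rightarrow> 'a::real_normed_field"
  assumes "x \<longlonglongrightarrow> L"
  shows "(\<lambda>n. (\<Sum>i<n. x i) / of_nat n) \<longlonglongrightarrow> L"
proof (rule LIMSEQ_I)
  fix e :: real assume e: "0 < e"
  then obtain N where N: "\<And>i. N \<le> i \<Longrightarrow> norm (x i - L) < e / 2"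
    using LIMSEQ_D[OF assms, of "e / 2"] by auto
  define S where "S = (\<Sum>i<N. norm (x i - L))"
  obtain K where K: "2 * S / e < real K" using reals_Archimedean2 by blast
  have "norm ((\<Sum>i<n. x i) / of_nat n - L) < e" if n: "Suc (N + K) \<le> n" for n
  proof -
    have n0: "of_nat n \<noteq> (0::'a)" "0 < real n" using n by auto
    have "norm (\<Sum>i<n. x i - L) \<le> (\<Sum>i<n. norm (x i - L))" by (rule norm_sum)
    also have "\<dots> = S + (\<Sum>i=N..<n. norm (x i - L))"
      unfolding S_def using n by (subst sum.union_disjoint[symmetric]) (auto intro!: sum.cong)
    also have "(\<Sum>i=N..<n. norm (x i - L)) \<le> (\<Sum>i=N..<n. e / 2)"
      using N by (intro sum_mono) (auto intro: less_imp_le)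
    also have "\<dots> \<le> n * (e / 2)" using n e by (simp add: mult_right_mono)
    also have "S < n * (e / 2)"
    proof -
      have "real K \<le> real n" using n by simp
      then have "2 * S / e < real n" using K by linarith
      then show ?thesis using e by (simp add: field_simps)
    qed
    finally have "norm (\<Sum>i<n. x i - L) < n * e" by (simp add: field_simps)
    moreover have "(\<Sum>i<n. x i) / of_nat n - L = (\<Sum>i<n. x i - L) / of_nat n"
      using n0 by (simp add: sum_subtractf diff_divide_distrib)
    ultimately show ?thesis using n0 by (simp add: norm_divide field_simps)
  qed
  then show "\<exists>no. \<forall>n\<ge>no. norm ((\<Sum>i<n. x i) / of_nat n - L) < e" by blast
qed

lemma holomorphic_on_wsum:
  assumes "\<And>k. k \<in> K \<Longrightarrow> (\<lambda>z. w z k) holomorphic_on S"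
  shows "(\<lambda>z. wsum K (w z) n g) holomorphic_on S"
proof (induction n arbitrary: g)
  case (Suc n)
  show ?case unfolding wsum.simps by (intro holomorphic_intros assms Suc)
qed simp

lemma holomorphic_on_mean_front: "(\<lambda>z. mean_front z n) holomorphic_on S"
  unfolding mean_front_def
proof (rule holomorphic_on_wsum)
  show "(\<lambda>z. geo_weight z (Suc n) k) holomorphic_on S" for k
    by (cases "k < Suc n") (auto simp: geo_weight_def intro!: holomorphic_intros)
qed

text \<open>Successive mean increments differ by geometrically small amounts, uniformly near
  \<open>p0\<close>, so they converge uniformly to a holomorphic limit; Cesaro averaging carries the
  limit to the ratios.\<close>

lemma mean_front_tendsto_holomorphic:
  fixes p0 :: real
  assumes "0 < p0" "p0 \<le> 1"
  shows "\<exists>e>0. \<exists>f. f holomorphic_on ball (complex_of_real p0) e \<and>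
    (\<forall>z\<in>ball (complex_of_real p0) e. (\<lambda>n. mean_front z n / of_nat n) \<longlonglongrightarrow> f z)"
proof -
  \<comment> \<open>Chosen above \<open>norm (1 - p0) = 1 - p0\<close>, so that
    \<open>norm (1 - z) < q\<close> persists near \<open>p0\<close>.\<close>
  define q where "q = 1 - p0 / 2"
  have q: "0 \<le> q" "q < 1" using assms by (auto simp: q_def)
  obtain R where R: "R > 1" and bad: "\<And>p N n. 1 - q \<le> p \<Longrightarrow> p \<le> 1 \<Longrightarrow> 1 \<le> N \<Longrightarrow>
      wsum {1..N} (geo_weight p N) n (\<lambda>xs. of_bool (\<not> renewal xs)) \<le> (1 / R) ^ n"
    using wsum_not_renewal_le[OF q] by blast
  \<comment> \<open>Strictly between 1 and \<open>R\<close>: \<open>norm z\<close> equals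
    \<open>1 - norm (1 - z)\<close> at \<open>p0\<close>, so it stays below \<open>M\<close> times
    it nearby, while \<open>M / R < 1\<close>.\<close>
  define M where "M = (1 + R) / 2"
  have M: "0 \<le> M" "1 < M" "M / R < 1" using R by (auto simp: M_def)
  let ?c = "complex_of_real p0"
  have n1: "norm (1 - ?c) = 1 - p0"
    using assms norm_of_real[of "1 - p0", where 'a = complex] by simp
  have "((\<lambda>z. norm (1 - z)) \<longlongrightarrow> norm (1 - ?c)) (nhds ?c)"
    by (intro tendsto_intros filterlim_ident)
  then have "eventually (\<lambda>z. norm (1 - z) < q) (nhds ?c)"
    using assms n1 by (intro order_tendstoD(2)) (auto simp: q_def)
  moreover have "((\<lambda>z. norm z - M * (1 - norm (1 - z))) \<longlongrightarrow> norm ?c - M * (1 - norm (1 - ?c))) (nhds ?c)"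
    by (intro tendsto_intros filterlim_ident)
  then have "eventually (\<lambda>z. norm z - M * (1 - norm (1 - z)) < 0) (nhds ?c)"
    using assms M(2) n1 by (intro order_tendstoD(2)) auto
  ultimately have "eventually (\<lambda>z. norm (1 - z) < q \<and> norm z - M * (1 - norm (1 - z)) < 0) (nhds ?c)"
    by eventually_elim auto
  then obtain e where e: "0 < e" "\<And>z. z \<in> ball ?c e \<Longrightarrow> norm (1 - z) < q \<and> norm z - M * (1 - norm (1 - z)) < 0"
    unfolding eventually_nhds_metric by (auto simp: dist_commute)
  define D where "D n z = mean_front z (Suc n) - mean_front z n" for n and z :: complex
  \<comment> \<open>The limit of \<open>D n\<close>, written as the telescoping series of
    differences to which the Weierstrass test applies.\<close>
  define f where "f z = D 0 z + (\<Sum>i. D (Suc i) z - D i z)" for z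
  have hol: "D n holomorphic_on ball ?c e" for n
    unfolding D_def by (intro holomorphic_intros holomorphic_on_mean_front)
  have "uniform_limit (ball ?c e) (\<lambda>n z. \<Sum>i<n. D (Suc i) z - D i z) (\<lambda>z. \<Sum>i. D (Suc i) z - D i z) sequentially"
  proof (rule Weierstrass_m_test)
    show "norm (D (Suc n) z - D n z) \<le> M * (M / R) ^ Suc n" if "z \<in> ball ?c e" for n z
      unfolding D_def using e(2)[OF that] q R M bad
      by (intro norm_mean_front_second_diff_le[where q = q]) auto
    show "summable (\<lambda>n. M * (M / R) ^ Suc n)"
      using M R by (intro summable_mult) (auto simp: summable_Suc_iff intro!: summable_geometric)
  qed
  then have "uniform_limit (ball ?c e) (\<lambda>n z. D 0 z + (\<Sum>i<n. D (Suc i) z - D i z)) f sequentially"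
    unfolding f_def by (intro uniform_limit_intros)
  moreover have "D 0 z + (\<Sum>i<n. D (Suc i) z - D i z) = D n z" for n z
    using sum_lessThan_telescope[of "\<lambda>i. D i z" n] by simp
  ultimately have lim: "uniform_limit (ball ?c e) D f sequentially" by (simp add: eta_contract_eq)
  have "f holomorphic_on ball ?c e"
  proof (rule holomorphic_uniform_sequence[OF open_ball hol])
    fix z assume "z \<in> ball ?c e"
    then obtain d where "0 < d" "cball z d \<subseteq> ball ?c e" using open_contains_cball open_ball by blast
    then show "\<exists>d. 0 < d \<and> cball z d \<subseteq> ball ?c e \<and> uniform_limit (cball z d) D f sequentially"
      using uniform_limit_on_subset[OF lim] by blast
  qed
  moreover have "(\<lambda>n. mean_front z n / of_nat n) \<longlonglongrightarrow> f z" if "z \<in> ball ?c e" for z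
  proof -
    have "(\<lambda>n. (\<Sum>i<n. D i z) / of_nat n) \<longlonglongrightarrow> f z"
      using tendsto_uniform_limitI[OF lim that] by (rule tendsto_cesaro)
    \<comment> \<open>The increments telescope from \<open>mean_front z 0 = 0\<close>.\<close>
    moreover have "(\<Sum>i<n. D i z) = mean_front z n" for n
      by (induction n) (simp_all add: D_def mean_front_def)
    ultimately show ?thesis by simp
  qed
  ultimately show ?thesis using e(1) by blast
qed

section \<open>Restriction to real parameters\<close>

lemma wsum_of_real:
  "wsum K (\<lambda>k. of_real (w k)) n (\<lambda>xs. of_real (g xs)) = (of_real (wsum K w n g) :: 'a::{real_algebra_1,comm_ring_1})"
  by (induction n arbitrary: g) simp_all

lemma mean_front_of_real: "mean_front (of_real p :: 'a::{real_algebra_1,comm_ring_1}) n = of_real (mean_front p n)"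
proof -
  have "geo_weight (of_real p :: 'a) (Suc n) = (\<lambda>k. of_real (geo_weight p (Suc n) k))"
    by (auto simp: geo_weight_def)
  then show ?thesis
    unfolding mean_front_def by (simp only: flip: wsum_of_real) simp
qed

lemma tendsto_mean_front_of_real:
  assumes "(\<lambda>n. mean_front (complex_of_real p) n / of_nat n) \<longlonglongrightarrow> l"
  shows "(\<lambda>n. mean_front p n / real n) \<longlonglongrightarrow> Re l"
proof -
  have "mean_front (complex_of_real p) n / of_nat n = of_real (mean_front p n / real n)" for n
    by (simp add: mean_front_of_real)
  with tendsto_Re[OF assms] show ?thesis by (simp only: Re_complex_of_real)
qed

text \<open>Near \<open>x0\<close> the limit is the real part of a holomorphic function on a complex
  ball, whose Taylor series converges on the whole real interval, also past 1. Since
  \<open>x - x0\<close> is real, real parts can be taken coefficient by coefficient.\<close>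

lemma mean_front_limit_analytic:
  assumes "\<And>p. 0 < p \<Longrightarrow> p \<le> 1 \<Longrightarrow> (\<lambda>n. mean_front p n / real n) \<longlonglongrightarrow> C p"
  shows "real_analytic_on C {0<..1}"
  unfolding real_analytic_on_def
proof
  fix x0 :: real assume x0: "x0 \<in> {0<..1}"
  then obtain e f where e: "0 < e" and f: "f holomorphic_on ball (complex_of_real x0) e"
    "\<And>z. z \<in> ball (complex_of_real x0) e \<Longrightarrow> (\<lambda>n. mean_front z n / of_nat n) \<longlonglongrightarrow> f z"
    using mean_front_tendsto_holomorphic[of x0] by auto
  define a where "a n = Re ((deriv ^^ n) f (of_real x0) / fact n)" for n
  have S: "(\<lambda>n. a n * (x - x0) ^ n) sums Re (f (of_real x))" if x: "x \<in> {x0 - e<..<x0 + e}" for x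
  proof -
    have *: "of_real x \<in> ball (complex_of_real x0) e"
      using x norm_of_real[of "x0 - x", where 'a = complex] by (auto simp: dist_norm)
    have "Re (w * (complex_of_real x - complex_of_real x0) ^ n) = Re w * (x - x0) ^ n" for w n
      by (simp flip: of_real_diff of_real_power)
    with sums_Re[OF holomorphic_power_series[OF f(1) *]]
    show ?thesis by (simp only: a_def)
  qed
  have "C x = Re (f (of_real x))" if x: "x \<in> {0<..1} \<inter> {x0 - e<..<x0 + e}" for x
  proof (rule LIMSEQ_unique)
    show "(\<lambda>n. mean_front x n / real n) \<longlonglongrightarrow> C x" using assms x by simp
    have "of_real x \<in> ball (complex_of_real x0) e"
      using x norm_of_real[of "x0 - x", where 'a = complex] by (auto simp: dist_norm)
    from tendsto_mean_front_of_real[OF f(2)[OF this]]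
    show "(\<lambda>n. mean_front x n / real n) \<longlonglongrightarrow> Re (f (of_real x))" .
  qed
  then show "\<exists>\<epsilon>>0. \<exists>a. (\<forall>x\<in>{x0 - \<epsilon><..<x0 + \<epsilon>}. summable (\<lambda>n. a n * (x - x0) ^ n)) \<and>
        (\<forall>x\<in>{0<..1} \<inter> {x0 - \<epsilon><..<x0 + \<epsilon>}. C x = (\<Sum>n. a n * (x - x0) ^ n))"
    using e S by (intro exI[of _ e] conjI exI[of _ a] ballI) (auto simp: sums_iff)
qed

section \<open>Variance of the front\<close>

lemma sum_power_rev_le:
  fixes r :: real
  assumes "0 \<le> r" "r < 1"
  shows "(\<Sum>i=1..n. r ^ (n + 1 - i)) \<le> 1 / (1 - r)"
proof -
  have "(\<Sum>i=1..n. r ^ (n + 1 - i)) = (\<Sum>j=1..n. r ^ j)"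
    by (rule sum.reindex_bij_witness[of _ "\<lambda>j. n + 1 - j" "\<lambda>i. n + 1 - i"]) auto
  also have "\<dots> \<le> (\<Sum>j. r ^ j)" using assms by (intro sum_le_suminf) auto
  also have "\<dots> = 1 / (1 - r)" using assms by (intro suminf_geometric) auto
  finally show ?thesis .
qed

lemma incr_drop_diff_le:
  assumes "set xs \<subseteq> {1..}"
  shows "\<bar>real (incr xs) - real (incr (drop i xs))\<bar> \<le> of_bool (\<not> renewal (drop i xs))"
proof -
  have s: "set (take i xs) \<subseteq> {1..}" "set (drop i xs) \<subseteq> {1..}"
    using assms by (auto dest: in_set_takeD in_set_dropD)
  have "incr xs = incr (drop i xs)" if "renewal (drop i xs)"
    using incr_renewal[OF that s] by (simp only: append_take_drop_id)
  moreover have "incr xs = 0 \<or> incr xs = 1" "incr (drop i xs) = 0 \<or> incr (drop i xs) = 1"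
    using incr_le_1[OF assms] incr_le_1[OF s(2)] by linarith+
  ultimately show ?thesis by (cases "renewal (drop i xs)") auto
qed

text \<open>In the covariance of two increments, the later one may be replaced by the increment
  computed from the letters after the earlier one, which is independent of it. The error is the
  weight of a stretch without renewal, so covariances are bounded geometrically in the gap and each
  new letter raises the variance bound by a constant.\<close>

lemma front_word_variance_bound:
  fixes p :: real
  assumes p: "0 < p" "p \<le> 1"
  shows "\<exists>K::real. 0 \<le> K \<and> (\<forall>N\<ge>1. \<forall>n.
    wsum {1..N} (geo_weight p N) n (\<lambda>xs. (real (front_word xs))\<^sup>2) -
    (wsum {1..N} (geo_weight p N) n (\<lambda>xs. real (front_word xs)))\<^sup>2 \<le> K * real n)"
proof -
  obtain R where R: "R > 1" and bad: "\<And>N n. 1 \<le> N \<Longrightarrow>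
      wsum {1..N} (geo_weight p N) n (\<lambda>xs. of_bool (\<not> renewal xs)) \<le> (1 / R) ^ n"
    using wsum_not_renewal_le[of "1 - p"] p by auto
  define r where "r = 1 / R"
  have r: "0 \<le> r" "r < 1" using R by (auto simp: r_def)
  \<comment> \<open>A new increment adds twice a covariance sum of at most
    \<open>2 / (1 - r)\<close> and its own second moment, at most 1.\<close>
  define K where "K = 4 / (1 - r) + 1"
  have "wsum {1..N} (geo_weight p N) n (\<lambda>xs. (real (front_word xs))\<^sup>2) -
    (wsum {1..N} (geo_weight p N) n (\<lambda>xs. real (front_word xs)))\<^sup>2 \<le> K * n" if N: "1 \<le> N" for N n
  proof -
    define W where "W = wsum {1..N} (geo_weight p N)"
    have w0: "0 \<le> geo_weight p N k" for k using geo_weight_nonneg p by simp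
    have w1: "sum (geo_weight p N) {1..N} = 1" using sum_geo_weight[OF N] .
    have mono: "W n g \<le> W n h" if "\<And>xs. length xs = n \<Longrightarrow> set xs \<subseteq> {1..} \<Longrightarrow> g xs \<le> h xs" for n g h
      unfolding W_def by (intro wsum_mono w0 that) auto
    have cong: "W n g = W n h" if "\<And>xs. length xs = n \<Longrightarrow> set xs \<subseteq> {1..} \<Longrightarrow> g xs = h xs" for n g h
      using that by (intro antisym mono) simp_all
    \<comment> \<open>The factor 2: replacing the later increment changes both the mixed moment and
      the product of means, each by at most the weight without renewal.\<close>
    have cov: "W (Suc n) (\<lambda>xs. real (incr (take i xs)) * real (incr xs)) -
        W (Suc n) (\<lambda>xs. real (incr (take i xs))) * W (Suc n) (\<lambda>xs. real (incr xs)) \<le> 2 * r ^ (n + 1 - i)"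
      if i: "i \<le> n" for i n
    proof -
      let ?a = "\<lambda>xs. real (incr (take i xs))" and ?h = "\<lambda>xs. real (incr (drop i xs))"
        and ?J = "\<lambda>xs. real (incr xs)" and ?B = "\<lambda>xs. of_bool (\<not> renewal (drop i xs))"
      have n: "Suc n = i + (n + 1 - i)" using i by simp
      have B: "W (Suc n) ?B \<le> r ^ (n + 1 - i)"
        unfolding W_def r_def using bad[OF N, of "n + 1 - i"]
          wsum_drop[OF w1, of i "n + 1 - i" "\<lambda>xs. of_bool (\<not> renewal xs)"] i
        by (simp del: wsum.simps power_Suc)
      have indep: "W (Suc n) (\<lambda>xs. ?a xs * ?h xs) = W (Suc n) ?a * W (Suc n) ?h"
        using wsum_take_drop[of "{1..N}" "geo_weight p N" i "n + 1 - i" "\<lambda>xs. real (incr xs)" "\<lambda>xs. real (incr xs)"]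
          wsum_take[OF w1, of i "n + 1 - i" "\<lambda>xs. real (incr xs)"]
          wsum_drop[OF w1, of i "n + 1 - i" "\<lambda>xs. real (incr xs)"]
        unfolding W_def n[symmetric] by (simp only:)
      have a01: "0 \<le> ?a xs" "?a xs \<le> 1" if "set xs \<subseteq> {1..}" for xs
        using incr_le_1[of "take i xs"] that by (auto dest: in_set_takeD)
      have Wa: "0 \<le> W (Suc n) ?a" "W (Suc n) ?a \<le> 1"
      proof -
        have "W (Suc n) (\<lambda>_. 0) \<le> W (Suc n) ?a" by (intro mono) simp
        then show "0 \<le> W (Suc n) ?a" unfolding W_def wsum_zero .
        have "W (Suc n) ?a \<le> W (Suc n) (\<lambda>_. 1)" using a01 by (intro mono)
        then show "W (Suc n) ?a \<le> 1" unfolding W_def wsum_const[OF w1] .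
      qed
      have "W (Suc n) (\<lambda>xs. ?a xs * ?J xs) \<le> W (Suc n) (\<lambda>xs. ?a xs * ?h xs + ?B xs)"
      proof (rule mono)
        fix xs :: "nat list" assume xs: "set xs \<subseteq> {1..}"
        have "?a xs * (?J xs - ?h xs) \<le> ?a xs * ?B xs"
          using a01(1)[OF xs] incr_drop_diff_le[OF xs, of i] by (intro mult_left_mono) linarith+
        also have "\<dots> \<le> ?B xs" using a01(2)[OF xs] by simp
        finally have "?a xs * (?J xs - ?h xs) \<le> ?B xs" .
        then show "?a xs * ?J xs \<le> ?a xs * ?h xs + ?B xs" by (simp add: algebra_simps)
      qed
      also have "\<dots> = W (Suc n) ?a * W (Suc n) ?h + W (Suc n) ?B"
        using indep unfolding W_def wsum_add by simp
      also have "W (Suc n) ?a * W (Suc n) ?h \<le> W (Suc n) ?a * (W (Suc n) ?J + W (Suc n) ?B)"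
      proof (intro mult_left_mono Wa)
        have "W (Suc n) ?h \<le> W (Suc n) (\<lambda>xs. ?J xs + ?B xs)"
        proof (rule mono)
          fix xs :: "nat list" assume xs: "set xs \<subseteq> {1..}"
          show "?h xs \<le> ?J xs + ?B xs" using incr_drop_diff_le[OF xs, of i] by linarith
        qed
        then show "W (Suc n) ?h \<le> W (Suc n) ?J + W (Suc n) ?B" unfolding W_def wsum_add .
      qed
      finally have "W (Suc n) (\<lambda>xs. ?a xs * ?J xs) - W (Suc n) ?a * W (Suc n) ?J \<le>
          W (Suc n) ?B + W (Suc n) ?a * W (Suc n) ?B" by (simp add: algebra_simps)
      also have "W (Suc n) ?a * W (Suc n) ?B \<le> 1 * r ^ (n + 1 - i)"
      proof (intro mult_mono Wa B)
        have "W (Suc n) (\<lambda>_. 0) \<le> W (Suc n) ?B" by (intro mono) simp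
        then show "0 \<le> W (Suc n) ?B" unfolding W_def wsum_zero .
      qed (use r in auto)
      finally show ?thesis using B by simp
    qed
    have "W n (\<lambda>xs. (real (front_word xs))\<^sup>2) - (W n (\<lambda>xs. real (front_word xs)))\<^sup>2 \<le> K * n" for n
    proof (induction n)
      case 0
      then show ?case by (simp add: W_def)
    next
      case (Suc n)
      let ?F = "\<lambda>xs. real (front_word xs)" and ?P = "\<lambda>xs. real (front_word (take n xs))"
        and ?J = "\<lambda>xs. real (incr xs)"
      have F: "?F xs = ?P xs + ?J xs" if "length xs = Suc n" "set xs \<subseteq> {1..}" for xs
      proof -
        have "xs = take n xs @ [last xs]" using that(1)
          by (metis append_butlast_last_id butlast_conv_take diff_Suc_1 list.size(3) nat.distinct(1))
        then have "front_word xs = front_word (take n xs) + incr xs"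
          using front_word_snoc(1)[of "take n xs" "last xs"] that(2) by metis
        then show ?thesis by simp
      qed
      have P: "?P xs = (\<Sum>i=1..n. real (incr (take i xs)))" if "length xs = Suc n" "set xs \<subseteq> {1..}" for xs
      proof -
        have "set (take n xs) \<subseteq> {1..}" using that(2) by (auto dest: in_set_takeD)
        from front_word_sum[OF this] show ?thesis using that(1) by (simp add: min_def)
      qed
      have "W (Suc n) (\<lambda>xs. (?F xs)\<^sup>2) = W (Suc n) (\<lambda>xs. (?P xs)\<^sup>2 + (2 * (?P xs * ?J xs) + (?J xs)\<^sup>2))"
        by (rule cong) (simp add: F power2_sum)
      also have "\<dots> = W n (\<lambda>xs. (?F xs)\<^sup>2) + (2 * W (Suc n) (\<lambda>xs. ?P xs * ?J xs) + W (Suc n) (\<lambda>xs. (?J xs)\<^sup>2))"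
        using wsum_take[OF w1, of n 1 "\<lambda>xs. (?F xs)\<^sup>2"]
        unfolding W_def wsum_add wsum_cmult by (simp del: wsum.simps)
      finally have F2: "W (Suc n) (\<lambda>xs. (?F xs)\<^sup>2) = \<dots>" .
      have "W (Suc n) ?F = W (Suc n) (\<lambda>xs. ?P xs + ?J xs)" by (rule cong) (simp add: F)
      also have "\<dots> = W n ?F + W (Suc n) ?J"
        using wsum_take[OF w1, of n 1 ?F] unfolding W_def wsum_add by (simp del: wsum.simps)
      finally have F1: "W (Suc n) ?F = \<dots>" .
      have "W (Suc n) (\<lambda>xs. ?P xs * ?J xs) = W (Suc n) (\<lambda>xs. \<Sum>i=1..n. real (incr (take i xs)) * ?J xs)"
        by (rule cong) (simp only: P sum_distrib_right)
      also have "\<dots> = (\<Sum>i=1..n. W (Suc n) (\<lambda>xs. real (incr (take i xs)) * ?J xs))"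
        unfolding W_def wsum_sum ..
      finally have PJ: "W (Suc n) (\<lambda>xs. ?P xs * ?J xs) = \<dots>" .
      have "W n ?F = W (Suc n) ?P"
        using wsum_take[OF w1, of n 1 ?F] unfolding W_def by (simp del: wsum.simps)
      also have "\<dots> = W (Suc n) (\<lambda>xs. \<Sum>i=1..n. real (incr (take i xs)))"
        by (rule cong) (simp only: P)
      also have "\<dots> = (\<Sum>i=1..n. W (Suc n) (\<lambda>xs. real (incr (take i xs))))"
        unfolding W_def wsum_sum ..
      finally have P1: "W n ?F = \<dots>" .
      have "W (Suc n) (\<lambda>xs. ?P xs * ?J xs) - W n ?F * W (Suc n) ?J \<le> (\<Sum>i=1..n. 2 * r ^ (n + 1 - i))"
        unfolding PJ P1 sum_distrib_right sum_subtractf[symmetric] using cov by (intro sum_mono) auto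
      also have "\<dots> \<le> 2 * (1 / (1 - r))"
        unfolding sum_distrib_left[symmetric] using sum_power_rev_le[OF r] by (intro mult_left_mono) auto
      finally have C: "W (Suc n) (\<lambda>xs. ?P xs * ?J xs) - W n ?F * W (Suc n) ?J \<le> 2 / (1 - r)" by simp
      have "W (Suc n) (\<lambda>xs. (?J xs)\<^sup>2) \<le> W (Suc n) (\<lambda>_. 1)"
        using incr_le_1 by (intro mono) (simp add: power_le_one)
      then have J: "W (Suc n) (\<lambda>xs. (?J xs)\<^sup>2) \<le> 1" unfolding W_def wsum_const[OF w1] .
      have "W (Suc n) (\<lambda>xs. (?F xs)\<^sup>2) - (W (Suc n) ?F)\<^sup>2 =
          (W n (\<lambda>xs. (?F xs)\<^sup>2) - (W n ?F)\<^sup>2) + 2 * (W (Suc n) (\<lambda>xs. ?P xs * ?J xs) - W n ?F * W (Suc n) ?J) +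
          (W (Suc n) (\<lambda>xs. (?J xs)\<^sup>2) - (W (Suc n) ?J)\<^sup>2)"
        unfolding F1 F2 power2_sum by algebra
      also have "\<dots> \<le> K * n + 2 * (2 / (1 - r)) + 1"
      proof (intro add_mono mult_left_mono Suc.IH C)
        show "W (Suc n) (\<lambda>xs. (?J xs)\<^sup>2) - (W (Suc n) ?J)\<^sup>2 \<le> 1"
          using J zero_le_power2[of "W (Suc n) ?J"] by linarith
      qed simp
      also have "\<dots> = K * Suc n" by (simp add: K_def algebra_simps add_divide_distrib)
      finally show ?case .
    qed
    then show ?thesis unfolding W_def .
  qed
  moreover have "0 \<le> K" using r by (simp add: K_def)
  ultimately show ?thesis by (intro exI[of _ K] conjI allI impI)
qed

section \<open>Longest paths as an infinite bin model\<close>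

text \<open>For finite \<open>S\<close>, the expectation of \<open>f\<close> at a random subset of
  \<open>S\<close> that keeps each element independently with probability \<open>p\<close>.\<close>

definition bernoulli_sum :: "real \<Rightarrow> 'b set \<Rightarrow> ('b set \<Rightarrow> real) \<Rightarrow> real" where
  "bernoulli_sum p S f = (\<Sum>T\<in>Pow S. p ^ card T * (1 - p) ^ card (S - T) * f T)"

lemma bernoulli_sum_empty [simp]: "bernoulli_sum p {} f = f {}"
  by (simp add: bernoulli_sum_def)

lemma bernoulli_sum_cong:
  "(\<And>T. T \<subseteq> S \<Longrightarrow> f T = g T) \<Longrightarrow> bernoulli_sum p S f = bernoulli_sum p S g"
  unfolding bernoulli_sum_def by (intro sum.cong) auto

lemma bernoulli_sum_add:
  "bernoulli_sum p S (\<lambda>T. f T + g T) = bernoulli_sum p S f + bernoulli_sum p S g"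
  by (simp add: bernoulli_sum_def distrib_left sum.distrib)

lemma bernoulli_sum_cmult: "bernoulli_sum p S (\<lambda>T. c * f T) = c * bernoulli_sum p S f"
  by (simp add: bernoulli_sum_def sum_distrib_left mult.left_commute)

lemma bernoulli_sum_sum:
  "finite I \<Longrightarrow> bernoulli_sum p S (\<lambda>T. \<Sum>i\<in>I. f i T) = (\<Sum>i\<in>I. bernoulli_sum p S (f i))"
  by (induction I rule: finite_induct) (simp_all add: bernoulli_sum_add, simp add: bernoulli_sum_def)

lemma bernoulli_sum_insert:
  assumes "finite S" "a \<notin> S"
  shows "bernoulli_sum p (insert a S) f =
    p * bernoulli_sum p S (\<lambda>T. f (insert a T)) + (1 - p) * bernoulli_sum p S f"
proof -
  have inj: "inj_on (insert a) (Pow S)" using assms by (auto simp: inj_on_def)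
  have "bernoulli_sum p (insert a S) f =
      (\<Sum>T\<in>Pow S. p ^ card T * (1 - p) ^ card (insert a S - T) * f T) +
      (\<Sum>T\<in>insert a ` Pow S. p ^ card T * (1 - p) ^ card (insert a S - T) * f T)"
    unfolding bernoulli_sum_def Pow_insert using assms by (intro sum.union_disjoint) auto
  also have "(\<Sum>T\<in>insert a ` Pow S. p ^ card T * (1 - p) ^ card (insert a S - T) * f T) =
      (\<Sum>T\<in>Pow S. p ^ card (insert a T) * (1 - p) ^ card (insert a S - insert a T) * f (insert a T))"
    using inj by (simp add: sum.reindex)
  also have "\<dots> = p * bernoulli_sum p S (\<lambda>T. f (insert a T))"
    unfolding bernoulli_sum_def sum_distrib_left
  proof (rule sum.cong[OF refl])
    fix T assume "T \<in> Pow S"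
    then have "finite T" "a \<notin> T" "insert a S - insert a T = S - T"
      using assms finite_subset by auto
    then show "p ^ card (insert a T) * (1 - p) ^ card (insert a S - insert a T) * f (insert a T) =
        p * (p ^ card T * (1 - p) ^ card (S - T) * f (insert a T))" by simp
  qed
  also have "(\<Sum>T\<in>Pow S. p ^ card T * (1 - p) ^ card (insert a S - T) * f T) = (1 - p) * bernoulli_sum p S f"
    unfolding bernoulli_sum_def sum_distrib_left
  proof (rule sum.cong[OF refl])
    fix T assume "T \<in> Pow S"
    then have "finite (S - T)" "a \<notin> S - T" "insert a S - T = insert a (S - T)"
      using assms by auto
    then show "p ^ card T * (1 - p) ^ card (insert a S - T) * f T =
        (1 - p) * (p ^ card T * (1 - p) ^ card (S - T) * f T)" by simp
  qed
  finally show ?thesis by simp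
qed

lemma bernoulli_sum_union:
  assumes "finite A" "finite B" "A \<inter> B = {}"
  shows "bernoulli_sum p (A \<union> B) f = bernoulli_sum p A (\<lambda>T. bernoulli_sum p B (\<lambda>U. f (T \<union> U)))"
  using assms(2,3)
proof (induction B arbitrary: f rule: finite_induct)
  case (insert b B)
  have "bernoulli_sum p (A \<union> insert b B) f = bernoulli_sum p (insert b (A \<union> B)) f" by simp
  also have "\<dots> = p * bernoulli_sum p (A \<union> B) (\<lambda>T. f (insert b T)) + (1 - p) * bernoulli_sum p (A \<union> B) f"
    using insert assms(1) by (intro bernoulli_sum_insert) auto
  also have "\<dots> = bernoulli_sum p A (\<lambda>T. p * bernoulli_sum p B (\<lambda>U. f (T \<union> insert b U)) + (1 - p) * bernoulli_sum p B (\<lambda>U. f (T \<union> U)))"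
    using insert by (simp add: bernoulli_sum_add bernoulli_sum_cmult)
  finally show ?case using insert by (simp add: bernoulli_sum_insert)
qed simp

lemma bernoulli_sum_const: "finite S \<Longrightarrow> bernoulli_sum p S (\<lambda>_. c) = c"
proof (induction S rule: finite_induct)
  case (insert a S)
  then show ?case by (simp add: bernoulli_sum_insert algebra_simps)
qed simp

lemma bernoulli_sum_hits:
  assumes "finite S" "X \<subseteq> S"
  shows "bernoulli_sum p S (\<lambda>T. of_bool (T \<inter> X \<noteq> {})) = 1 - (1 - p) ^ card X"
  using assms
proof (induction S arbitrary: X rule: finite_induct)
  case (insert a S)
  show ?case
  proof (cases "a \<in> X")
    case True
    have X: "X - {a} \<subseteq> S" "finite X" using insert.prems insert.hyps finite_subset by auto
    have "bernoulli_sum p (insert a S) (\<lambda>T. of_bool (T \<inter> X \<noteq> {})) =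
        p * bernoulli_sum p S (\<lambda>T. of_bool (insert a T \<inter> X \<noteq> {})) + (1 - p) * bernoulli_sum p S (\<lambda>T. of_bool (T \<inter> X \<noteq> {}))"
      using insert.hyps by (rule bernoulli_sum_insert)
    also have "bernoulli_sum p S (\<lambda>T. of_bool (insert a T \<inter> X \<noteq> {})) = 1"
      using True insert.hyps(1) by (simp add: bernoulli_sum_const)
    also have "bernoulli_sum p S (\<lambda>T. of_bool (T \<inter> X \<noteq> {})) = bernoulli_sum p S (\<lambda>T. of_bool (T \<inter> (X - {a}) \<noteq> {}))"
      using insert.hyps(2) by (intro bernoulli_sum_cong arg_cong[where f = of_bool]) blast
    also have "\<dots> = 1 - (1 - p) ^ card (X - {a})" using X(1) by (rule insert.IH)
    finally show ?thesis
      unfolding card_Suc_Diff1[OF X(2) True, symmetric] by (simp add: algebra_simps)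
  next
    case False
    then have "X \<subseteq> S" using insert.prems by auto
    then show ?thesis using insert False by (simp add: bernoulli_sum_insert algebra_simps)
  qed
qed simp

text \<open>The ends of increasing paths with \<open>v\<close> edges that start in the positive
  integers, built by appending the last edge.\<close>

primrec reach :: "(int \<times> int) set \<Rightarrow> nat \<Rightarrow> int set" where
  "reach E 0 = {1..}"
| "reach E (Suc v) = {j. \<exists>i\<in>reach E v. i < j \<and> (i, j) \<in> E}"

definition edges_upto :: "nat \<Rightarrow> (int \<times> int) set" where
  "edges_upto n = {(i, j). 1 \<le> i \<and> i < j \<and> j \<le> int n}"

definition new_edges :: "nat \<Rightarrow> (int \<times> int) set" where
  "new_edges n = {1..int n} \<times> {int n + 1}"

text \<open>The ball of a vertex lies in the bin whose index is one plus the length of the longest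
  path ending there; as shorter paths to it exist too, this counts the balls beyond bin
  \<open>v\<close>.\<close>

definition path_config :: "(int \<times> int) set \<Rightarrow> nat \<Rightarrow> nat \<Rightarrow> nat" where
  "path_config E n v = card (reach E v \<inter> {1..int n})"

lemma finite_edges_upto [simp]: "finite (edges_upto n)"
  by (rule finite_subset[of _ "{1..int n} \<times> {1..int n}"]) (auto simp: edges_upto_def)

lemma edges_upto_Suc: "edges_upto (Suc n) = edges_upto n \<union> new_edges n"
  by (auto simp: edges_upto_def new_edges_def)

text \<open>Dropping the first edge of a path keeps its end and leaves a path that still starts at a
  positive vertex.\<close>

lemma reach_Suc_subset: "reach E (Suc v) \<subseteq> reach E v"
proof (induction v)
  case (Suc v)
  then show ?case by (subst (1 2) reach.simps) blast
qed auto

lemma reach_ge: "j \<in> reach E v \<Longrightarrow> int v + 1 \<le> j"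
proof (induction v arbitrary: j)
  case (Suc v)
  then obtain i where "i \<in> reach E v" "i < j" by auto
  with Suc.IH[of i] show ?case by simp
qed simp

text \<open>Edges go upward, so a path from a positive vertex to one in \<open>{1..int n}\<close>
  uses only edges of \<open>edges_upto n\<close>.\<close>

lemma reach_cong:
  assumes "E \<inter> edges_upto n = E' \<inter> edges_upto n"
  shows "reach E v \<inter> {1..int n} = reach E' v \<inter> {1..int n}"
proof (induction v)
  case (Suc v)
  have "j \<in> reach F' (Suc v)"
    if F: "F \<inter> edges_upto n = F' \<inter> edges_upto n" "reach F v \<inter> {1..int n} = reach F' v \<inter> {1..int n}"
      and j: "j \<in> reach F (Suc v)" "j \<le> int n" for F F' j
  proof -
    obtain i where i: "i \<in> reach F v" "i < j" "(i, j) \<in> F" using j(1) by auto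
    then have i1: "1 \<le> i" using reach_ge[of i F v] by simp
    then have "(i, j) \<in> F \<inter> edges_upto n" using i j(2) by (simp add: edges_upto_def)
    moreover have "i \<in> reach F v \<inter> {1..int n}" using i i1 j(2) by simp
    ultimately show ?thesis using i(2) unfolding F by auto
  qed
  from this[OF assms Suc] this[OF assms[symmetric] Suc[symmetric]] show ?case
    by (auto simp del: reach.simps(2))
qed simp

lemma path_config_cong:
  "E \<inter> edges_upto n = E' \<inter> edges_upto n \<Longrightarrow> path_config E n = path_config E' n"
  by (simp add: path_config_def fun_eq_iff reach_cong[of E n E'])

lemma path_config_le: "path_config E n v \<le> n"
  using card_mono[of "{1..int n}" "reach E v \<inter> {1..int n}"] by (simp add: path_config_def)

lemma path_config_eq_0:
  assumes "n \<le> v"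
  shows "path_config E n v = 0"
proof -
  have "j \<notin> {1..int n}" if "j \<in> reach E v" for j
    using reach_ge[OF that] assms by simp
  then have "reach E v \<inter> {1..int n} = {}" by blast
  then show ?thesis by (simp add: path_config_def)
qed

lemma path_config_pos_iff: "0 < path_config E n v \<longleftrightarrow> reach E v \<inter> {1..int n} \<noteq> {}"
  by (simp add: path_config_def card_gt_0_iff)

lemma bin_config_path_config: "bin_config (path_config E n)"
  unfolding bin_config_def
proof
  have "path_config E n (Suc v) \<le> path_config E n v" for v
    unfolding path_config_def using reach_Suc_subset[of E v] by (intro card_mono) auto
  then show "antimono (path_config E n)" unfolding antimono_def by (metis lift_Suc_antimono_le)
  show "\<exists>v. path_config E n v = 0" using path_config_eq_0 by blast
qed

text \<open>Common form of reading a letter and adding a vertex: \<open>Q u\<close> says that the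
  new ball lies beyond bin \<open>Suc u\<close>.\<close>

definition add_ball :: "(nat \<Rightarrow> nat) \<Rightarrow> (nat \<Rightarrow> bool) \<Rightarrow> nat \<Rightarrow> nat" where
  "add_ball c Q = (\<lambda>v. c v + (case v of 0 \<Rightarrow> 1 | Suc u \<Rightarrow> of_bool (Q u)))"

lemma ibm_step_eq_add_ball: "ibm_step k c = add_ball c (\<lambda>u. k \<le> c u)"
  by (simp add: ibm_step_def add_ball_def)

lemma path_config_Suc:
  assumes "T \<subseteq> edges_upto n" "U \<subseteq> new_edges n"
  shows "path_config (T \<union> U) (Suc n) =
    add_ball (path_config T n) (\<lambda>u. U \<inter> (reach T u \<inter> {1..int n}) \<times> {int n + 1} \<noteq> {})"
proof
  fix v
  let ?E = "T \<union> U" and ?m = "int n + 1"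
  have old: "reach ?E v \<inter> {1..int n} = reach T v \<inter> {1..int n}" for v
    using assms(2) by (intro reach_cong) (auto simp: new_edges_def edges_upto_def)
  have split: "reach ?E v \<inter> {1..int (Suc n)} = (reach ?E v \<inter> {1..int n}) \<union> (reach ?E v \<inter> {?m})"
    by auto
  have "path_config ?E (Suc n) v = path_config T n v + card (reach ?E v \<inter> {?m})"
    unfolding path_config_def split old[symmetric] by (intro card_Un_disjoint) auto
  also have "card (reach ?E v \<inter> {?m}) = of_bool (?m \<in> reach ?E v)" by simp
  also have "\<dots> = (case v of 0 \<Rightarrow> 1 | Suc u \<Rightarrow> of_bool (U \<inter> (reach T u \<inter> {1..int n}) \<times> {?m} \<noteq> {}))"
  proof (cases v)
    case (Suc u)
    have "?m \<in> reach ?E (Suc u) \<longleftrightarrow> (\<exists>i. i \<in> reach ?E u \<and> i < ?m \<and> (i, ?m) \<in> ?E)" by auto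
    also have "\<dots> \<longleftrightarrow> (\<exists>i. i \<in> reach ?E u \<inter> {1..int n} \<and> (i, ?m) \<in> U)"
      using assms(1) reach_ge[of _ ?E u] assms(2) by (force simp: edges_upto_def new_edges_def)
    also have "\<dots> \<longleftrightarrow> U \<inter> (reach T u \<inter> {1..int n}) \<times> {?m} \<noteq> {}"
      unfolding old by auto
    finally show ?thesis using Suc by simp
  qed simp
  finally show "path_config ?E (Suc n) v =
      add_ball (path_config T n) (\<lambda>u. U \<inter> (reach T u \<inter> {1..int n}) \<times> {?m} \<noteq> {}) v"
    by (simp add: add_ball_def)
qed

text \<open>Such a \<open>Q\<close> is \<open>\<lambda>u. u < J\<close> for a threshold
  \<open>J\<close>, so \<open>\<phi> Q\<close> is an affine combination of the indicators of the
  single events \<open>Q v\<close>. For random \<open>Q\<close> its expectation hence depends only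
  on the probability of each \<open>Q v\<close>.\<close>

lemma antitone_pred_telescope:
  fixes \<phi> :: "(nat \<Rightarrow> bool) \<Rightarrow> real"
  assumes "\<And>v. Q (Suc v) \<Longrightarrow> Q v" "\<not> Q n"
  shows "\<phi> Q = \<phi> (\<lambda>_. False) + (\<Sum>v<n. (\<phi> (\<lambda>u. u < Suc v) - \<phi> (\<lambda>u. u < v)) * of_bool (Q v))"
proof -
  define J where "J = (LEAST v. \<not> Q v)"
  have J: "\<not> Q J" "J \<le> n"
    unfolding J_def using LeastI[of "\<lambda>v. \<not> Q v", OF assms(2)] Least_le[of "\<lambda>v. \<not> Q v", OF assms(2)]
    by blast+
  have anti: "Q a" if "a \<le> b" "Q b" for a b
    using that by (induction rule: inc_induct) (auto intro: assms(1))
  have Q: "Q v \<longleftrightarrow> v < J" for v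
    using not_less_Least[of v "\<lambda>v. \<not> Q v", folded J_def] anti[of J v] J(1) by fastforce
  have "(\<Sum>v<n. (\<phi> (\<lambda>u. u < Suc v) - \<phi> (\<lambda>u. u < v)) * of_bool (Q v)) = (\<Sum>v<J. \<phi> (\<lambda>u. u < Suc v) - \<phi> (\<lambda>u. u < v))"
    using J(2) by (intro sum.mono_neutral_cong_right) (auto simp: Q)
  also have "\<dots> = \<phi> (\<lambda>u. u < J) - \<phi> (\<lambda>u. u < 0)"
    by (rule sum_lessThan_telescope)
  finally have "(\<Sum>v<n. (\<phi> (\<lambda>u. u < Suc v) - \<phi> (\<lambda>u. u < v)) * of_bool (Q v)) = \<phi> (\<lambda>u. u < J) - \<phi> (\<lambda>_. False)"
    by simp
  moreover have "Q = (\<lambda>u. u < J)" using Q by blast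
  ultimately show ?thesis by simp
qed

text \<open>The label of a new vertex exceeds \<open>v\<close> iff it receives an edge from one of the \<open>c v\<close> vertices
  ending a path with \<open>v\<close> edges, which has probability \<open>1 - (1 - p) ^ c v\<close>: the same as for a
  geometric rank to be at most \<open>c v\<close>.\<close>
lemma bernoulli_sum_path_config_step:
  assumes "T \<subseteq> edges_upto n" "n < N"
  shows "bernoulli_sum p (new_edges n) (\<lambda>U. g (path_config (T \<union> U) (Suc n))) =
    (\<Sum>k=1..N. geo_weight p N k * g (ibm_step k (path_config T n)))"
proof -
  define c where "c = path_config T n"
  define X where "X u = (reach T u \<inter> {1..int n}) \<times> {int n + 1}" for u
  define \<phi> where "\<phi> Q = g (add_ball c Q)" for Q
  define d where "d v = \<phi> (\<lambda>u. u < Suc v) - \<phi> (\<lambda>u. u < v)" for v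
  have fin: "finite (new_edges n)" by (simp add: new_edges_def)
  have X: "X (Suc v) \<subseteq> X v" "X v \<subseteq> new_edges n" "card (X v) = c v" for v
    using reach_Suc_subset[of T v] by (auto simp: X_def new_edges_def c_def path_config_def card_cartesian_product)
  have c: "bin_config c" "c v \<le> n" "c n = 0" for v
    by (simp_all add: c_def bin_config_path_config path_config_le path_config_eq_0)
  have Xn: "X n = {}" using X(3)[of n] c(3) finite_subset[OF X(2) fin] by simp
  have "bernoulli_sum p (new_edges n) (\<lambda>U. g (path_config (T \<union> U) (Suc n))) =
      bernoulli_sum p (new_edges n) (\<lambda>U. \<phi> (\<lambda>_. False) + (\<Sum>v<n. d v * of_bool (U \<inter> X v \<noteq> {})))"
  proof (rule bernoulli_sum_cong)
    fix U assume U: "U \<subseteq> new_edges n"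
    have "\<phi> (\<lambda>u. U \<inter> X u \<noteq> {}) = \<phi> (\<lambda>_. False) + (\<Sum>v<n. d v * of_bool (U \<inter> X v \<noteq> {}))"
      unfolding d_def using X(1) Xn by (intro antitone_pred_telescope) auto
    then show "g (path_config (T \<union> U) (Suc n)) = \<phi> (\<lambda>_. False) + (\<Sum>v<n. d v * of_bool (U \<inter> X v \<noteq> {}))"
      unfolding path_config_Suc[OF assms(1) U] by (simp only: \<phi>_def X_def c_def)
  qed
  also have "\<dots> = \<phi> (\<lambda>_. False) + (\<Sum>v<n. d v * (1 - (1 - p) ^ c v))"
    using fin X(2,3) by (simp only: bernoulli_sum_add bernoulli_sum_sum bernoulli_sum_cmult
        bernoulli_sum_const bernoulli_sum_hits finite_lessThan)
  also have "\<dots> = (\<Sum>k=1..N. geo_weight p N k) * \<phi> (\<lambda>_. False) +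
      (\<Sum>v<n. d v * (\<Sum>k=1..N. geo_weight p N k * of_bool (k \<le> c v)))"
  proof -
    have "(\<Sum>k=1..N. geo_weight p N k * of_bool (k \<le> c v)) = 1 - (1 - p) ^ c v" for v
      using c(2)[of v] assms(2) by (intro sum_geo_weight_le) simp
    then show ?thesis using sum_geo_weight[of N p] assms(2) by (simp del: sum_mult_of_bool_eq sum_of_bool_mult_eq)
  qed
  also have "\<dots> = (\<Sum>k=1..N. geo_weight p N k * (\<phi> (\<lambda>_. False) + (\<Sum>v<n. d v * of_bool (k \<le> c v))))"
    unfolding sum_distrib_left sum_distrib_right distrib_left sum.distrib
    by (subst (2) sum.swap) (simp only: mult.left_commute)
  \<comment> \<open>The same expansion read backwards, now for the events \<open>k \<le> c u\<close>
    of a letter.\<close>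
  also have "\<dots> = (\<Sum>k=1..N. geo_weight p N k * g (ibm_step k c))"
  proof (rule sum.cong[OF refl])
    fix k assume k: "k \<in> {1..N}"
    have "\<phi> (\<lambda>u. k \<le> c u) = \<phi> (\<lambda>_. False) + (\<Sum>v<n. d v * of_bool (k \<le> c v))"
      unfolding d_def
    proof (rule antitone_pred_telescope)
      show "k \<le> c v" if "k \<le> c (Suc v)" for v
        using that c(1) antimonoD[of c v "Suc v"] by (simp add: bin_config_def)
    qed (use k c(3) in simp)
    then show "geo_weight p N k * (\<phi> (\<lambda>_. False) + (\<Sum>v<n. d v * of_bool (k \<le> c v))) = geo_weight p N k * g (ibm_step k c)"
      by (simp only: \<phi>_def ibm_step_eq_add_ball)
  qed
  finally show ?thesis by (simp only: c_def)
qed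

text \<open>Edges into the next vertex are independent of the earlier ones, and their effect depends
  in law only on the current configuration. The laws are matched at each fixed \<open>n\<close>,
  which suffices for the moments of the front.\<close>

lemma bernoulli_sum_path_config:
  assumes "n < N"
  shows "bernoulli_sum p (edges_upto n) (\<lambda>T. g (path_config T n)) =
    wsum {1..N} (geo_weight p N) n (\<lambda>xs. g (ibm_run xs))"
  using assms
proof (induction n arbitrary: g)
  case 0
  have "edges_upto 0 = {}" by (auto simp: edges_upto_def)
  moreover have "path_config {} 0 = (\<lambda>_. 0)" by (simp add: path_config_def fun_eq_iff)
  ultimately show ?case by simp
next
  case (Suc n)
  have "bernoulli_sum p (edges_upto (Suc n)) (\<lambda>T. g (path_config T (Suc n))) =
      bernoulli_sum p (edges_upto n) (\<lambda>T. bernoulli_sum p (new_edges n) (\<lambda>U. g (path_config (T \<union> U) (Suc n))))"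
    unfolding edges_upto_Suc
  proof (intro bernoulli_sum_union)
    show "finite (new_edges n)" by (simp add: new_edges_def)
    show "edges_upto n \<inter> new_edges n = {}" by (auto simp: edges_upto_def new_edges_def)
  qed simp
  also have "\<dots> = bernoulli_sum p (edges_upto n) (\<lambda>T. \<Sum>k=1..N. geo_weight p N k * g (ibm_step k (path_config T n)))"
    using Suc.prems by (intro bernoulli_sum_cong bernoulli_sum_path_config_step) auto
  also have "\<dots> = wsum {1..N} (geo_weight p N) n (\<lambda>xs. \<Sum>k=1..N. geo_weight p N k * g (ibm_step k (ibm_run xs)))"
    using Suc.prems by (intro Suc.IH[of "\<lambda>c. \<Sum>k=1..N. geo_weight p N k * g (ibm_step k c)"]) simp
  also have "\<dots> = wsum {1..N} (geo_weight p N) (Suc n) (\<lambda>xs. g (ibm_run xs))"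
    by (simp only: wsum_snoc ibm_run_snoc)
  finally show ?case .
qed

section \<open>Reach sets and directed paths\<close>

lemma directed_path_last_reach:
  assumes "directed_path (edge_set \<omega>) xs" "1 \<le> hd xs"
  shows "last xs \<in> reach (edge_set \<omega>) (length xs - 1)"
proof -
  have "xs \<noteq> []" "successively (\<lambda>u v. (u, v) \<in> edge_set \<omega>) xs"
    using assms(1) by (auto simp: directed_path_def)
  then show ?thesis using assms(2)
  proof (induction xs rule: rev_induct)
    case (snoc x xs)
    show ?case
    proof (cases "xs = []")
      case False
      then have "last xs \<in> reach (edge_set \<omega>) (length xs - 1)" "(last xs, x) \<in> edge_set \<omega>"
        using snoc by (auto simp: successively_append_iff)
      moreover obtain m where "length xs = Suc m" using False by (cases xs) auto
      ultimately show ?thesis by (auto simp: edge_set_def)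
    qed (use snoc in auto)
  qed simp
qed

lemma reach_imp_directed_path:
  assumes "j \<in> reach (edge_set \<omega>) v"
  shows "\<exists>xs. directed_path (edge_set \<omega>) xs \<and> length xs = Suc v \<and> 1 \<le> hd xs \<and> hd xs \<le> j \<and> last xs = j"
proof -
  \<comment> \<open>The bound \<open>x \<le> j\<close> on all vertices is added for the induction:
    it makes the appended vertex distinct from the earlier ones.\<close>
  have "\<exists>xs. xs \<noteq> [] \<and> distinct xs \<and> (\<forall>x\<in>set xs. x \<le> j) \<and> successively (\<lambda>u v. (u, v) \<in> edge_set \<omega>) xs \<and>
      length xs = Suc v \<and> 1 \<le> hd xs \<and> last xs = j"
    using assms
  proof (induction v arbitrary: j)
    case 0
    then show ?case by (intro exI[of _ "[j]"]) auto
  next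
    case (Suc v)
    then obtain i where i: "i \<in> reach (edge_set \<omega>) v" "i < j" "(i, j) \<in> edge_set \<omega>" by auto
    from Suc.IH[OF i(1)] obtain xs where xs: "xs \<noteq> []" "distinct xs" "\<forall>x\<in>set xs. x \<le> i"
      "successively (\<lambda>u v. (u, v) \<in> edge_set \<omega>) xs" "length xs = Suc v" "1 \<le> hd xs" "last xs = i" by blast
    then show ?case using i
      by (intro exI[of _ "xs @ [j]"]) (fastforce simp: successively_append_iff)
  qed
  then show ?thesis unfolding directed_path_def by (metis hd_in_set)
qed

text \<open>The offset 1 arises because a single vertex is a path of length 0 while its ball lies in
  bin 1.\<close>

lemma front_path_config:
  assumes "1 \<le> n"
  shows "front (path_config (edge_set \<omega>) n) = Suc (longest_path n \<omega>)"
proof -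
  let ?S = "{length xs - 1 |xs. directed_path (edge_set \<omega>) xs \<and> hd xs \<in> {1..int n} \<and> last xs \<in> {1..int n}}"
  let ?c = "path_config (edge_set \<omega>) n"
  have S: "?S = {v. 0 < ?c v}"
  proof (intro set_eqI iffI)
    fix v assume "v \<in> ?S"
    then obtain xs where "v = length xs - 1" "directed_path (edge_set \<omega>) xs" "hd xs \<in> {1..int n}" "last xs \<in> {1..int n}"
      by auto
    then show "v \<in> {v. 0 < ?c v}" using directed_path_last_reach[of \<omega> xs] by (auto simp: path_config_pos_iff)
  next
    fix v assume "v \<in> {v. 0 < ?c v}"
    then have "reach (edge_set \<omega>) v \<inter> {1..int n} \<noteq> {}" by (simp add: path_config_pos_iff)
    then obtain j where j: "j \<in> reach (edge_set \<omega>) v" "j \<in> {1..int n}" by blast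
    obtain xs where xs: "directed_path (edge_set \<omega>) xs" "length xs = Suc v" "1 \<le> hd xs" "hd xs \<le> j" "last xs = j"
      using reach_imp_directed_path[OF j(1)] by blast
    have "v = length xs - 1 \<and> directed_path (edge_set \<omega>) xs \<and> hd xs \<in> {1..int n} \<and> last xs \<in> {1..int n}"
      using xs j(2) by simp
    then show "v \<in> ?S" by (intro CollectI exI)
  qed
  also have "\<dots> = {..<front ?c}" using bin_config_pos_iff[OF bin_config_path_config] by auto
  finally have S: "?S = {..<front ?c}" .
  have "1 \<in> reach (edge_set \<omega>) 0 \<inter> {1..int n}" using assms by simp
  then have "0 < ?c 0" unfolding path_config_pos_iff by blast
  then have "0 < front ?c" using bin_config_pos_iff[OF bin_config_path_config] by simp
  then have "Max {..<front ?c} = front ?c - 1" by (intro Max_eqI) auto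
  then show ?thesis unfolding longest_path_def S using \<open>0 < front ?c\<close> by simp
qed

section \<open>Almost sure convergence\<close>

lemma prob_space_barak_erdos: "prob_space (barak_erdos p)"
  unfolding barak_erdos_def by (intro prob_space_PiM prob_space_measure_pmf)

lemma barak_erdos_edge_set_cylinder:
  assumes p: "0 \<le> p" "p \<le> 1" and S: "finite S" "S \<subseteq> {(i, j). i < j}" "T \<subseteq> S"
  shows "{\<omega> \<in> space (barak_erdos p). edge_set \<omega> \<inter> S = T} \<in> sets (barak_erdos p)" (is "?A \<in> _")
    and "measure (barak_erdos p) {\<omega> \<in> space (barak_erdos p). edge_set \<omega> \<inter> S = T} =
      p ^ card T * (1 - p) ^ card (S - T)"
proof -
  let ?I = "{(i, j). i < (j::int)}" and ?M = "\<lambda>_::int \<times> int. measure_pmf (bernoulli_pmf p)"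
  interpret product_prob_space ?M ?I ..
  let ?X = "\<lambda>e. {e \<in> T}"
  have eq: "?A = prod_emb ?I ?M S (Pi\<^sub>E S ?X)"
  proof -
    have "edge_set \<omega> \<inter> S = T \<longleftrightarrow> (\<forall>e\<in>S. \<omega> e \<longleftrightarrow> e \<in> T)" for \<omega> :: "int \<times> int \<Rightarrow> bool"
      using S(2,3) by (auto simp: edge_set_def)
    then show ?thesis
      using S(2) unfolding prod_emb_def barak_erdos_def by (auto simp: space_PiM restrict_PiE_iff)
  qed
  show "?A \<in> sets (barak_erdos p)"
    unfolding eq unfolding barak_erdos_def using S by (intro sets_PiM_I) auto
  have "measure (barak_erdos p) ?A = (\<Prod>e\<in>S. measure_pmf.prob (bernoulli_pmf p) {e \<in> T})"
    unfolding eq unfolding barak_erdos_def using S by (intro measure_PiM_emb) auto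
  also have "\<dots> = (\<Prod>e\<in>S. if e \<in> T then p else 1 - p)"
    using p by (intro prod.cong) (auto simp: measure_pmf_single)
  also have "\<dots> = (\<Prod>e\<in>T. p) * (\<Prod>e\<in>S - T. 1 - p)"
  proof -
    have "(\<Prod>e\<in>S - T. if e \<in> T then p else 1 - p) = (\<Prod>e\<in>S - T. 1 - p)"
      by (rule prod.cong) auto
    then show ?thesis by (simp add: prod.subset_diff[OF S(3) S(1)] mult.commute)
  qed
  finally show "measure (barak_erdos p) ?A = p ^ card T * (1 - p) ^ card (S - T)" by simp
qed

text \<open>A function of finitely many edges is a finite combination of indicators of cylinders,
  which yields both claims.\<close>

lemma
  fixes f :: "(int \<times> int) set \<Rightarrow> real"
  assumes p: "0 \<le> p" "p \<le> 1" and S: "finite S" "S \<subseteq> {(i, j). i < j}"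
  shows integrable_edge_set: "integrable (barak_erdos p) (\<lambda>\<omega>. f (edge_set \<omega> \<inter> S))"
    and expectation_edge_set: "(\<integral>\<omega>. f (edge_set \<omega> \<inter> S) \<partial>barak_erdos p) = bernoulli_sum p S f"
proof -
  interpret prob_space "barak_erdos p" by (rule prob_space_barak_erdos)
  define A where "A T = {\<omega> \<in> space (barak_erdos p). edge_set \<omega> \<inter> S = T}" for T
  note cyl = barak_erdos_edge_set_cylinder[OF p S, folded A_def]
  have eq: "f (edge_set \<omega> \<inter> S) = (\<Sum>T\<in>Pow S. f T * indicator (A T) \<omega>)" if "\<omega> \<in> space (barak_erdos p)" for \<omega>
  proof -
    have "(\<Sum>T\<in>Pow S. f T * indicator (A T) \<omega>) = (\<Sum>T\<in>{edge_set \<omega> \<inter> S}. f T * indicator (A T) \<omega>)"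
      using S(1) that by (intro sum.mono_neutral_right) (auto simp: A_def indicator_def)
    then show ?thesis using that by (simp add: A_def)
  qed
  have int: "integrable (barak_erdos p) (\<lambda>\<omega>. f T * indicator (A T) \<omega>)" if "T \<in> Pow S" for T
    using cyl(1)[of T] that by (intro integrable_mult_right integrable_real_indicator) (auto simp: emeasure_eq_measure)
  have "integrable (barak_erdos p) (\<lambda>\<omega>. \<Sum>T\<in>Pow S. f T * indicator (A T) \<omega>)"
    using int by (rule Bochner_Integration.integrable_sum)
  then show "integrable (barak_erdos p) (\<lambda>\<omega>. f (edge_set \<omega> \<inter> S))"
    using eq by (simp cong: Bochner_Integration.integrable_cong)
  have "(\<integral>\<omega>. f (edge_set \<omega> \<inter> S) \<partial>barak_erdos p) = (\<integral>\<omega>. (\<Sum>T\<in>Pow S. f T * indicator (A T) \<omega>) \<partial>barak_erdos p)"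
    using eq by (intro Bochner_Integration.integral_cong) auto
  also have "\<dots> = (\<Sum>T\<in>Pow S. \<integral>\<omega>. f T * indicator (A T) \<omega> \<partial>barak_erdos p)"
    using int by (rule Bochner_Integration.integral_sum)
  also have "\<dots> = bernoulli_sum p S f"
    unfolding bernoulli_sum_def
  proof (rule sum.cong[OF refl])
    fix T assume "T \<in> Pow S"
    then have "T \<subseteq> S" by simp
    moreover have "A T \<inter> space (barak_erdos p) = A T" by (auto simp: A_def)
    ultimately show "(\<integral>\<omega>. f T * indicator (A T) \<omega> \<partial>barak_erdos p) = p ^ card T * (1 - p) ^ card (S - T) * f T"
      using cyl(2)[of T] by simp
  qed
  finally show "(\<integral>\<omega>. f (edge_set \<omega> \<inter> S) \<partial>barak_erdos p) = bernoulli_sum p S f" .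
qed

lemma
  fixes g :: "(nat \<Rightarrow> nat) \<Rightarrow> real"
  assumes p: "0 \<le> p" "p \<le> 1"
  shows integrable_path_config: "integrable (barak_erdos p) (\<lambda>\<omega>. g (path_config (edge_set \<omega>) n))"
    and expectation_path_config: "(\<integral>\<omega>. g (path_config (edge_set \<omega>) n) \<partial>barak_erdos p) =
      wsum {1..Suc n} (geo_weight p (Suc n)) n (\<lambda>xs. g (ibm_run xs))"
proof -
  have eq: "path_config (edge_set \<omega>) n = path_config (edge_set \<omega> \<inter> edges_upto n) n" for \<omega>
    by (rule path_config_cong) simp
  have sub: "edges_upto n \<subseteq> {(i, j). i < j}" by (auto simp: edges_upto_def)
  show "integrable (barak_erdos p) (\<lambda>\<omega>. g (path_config (edge_set \<omega>) n))"
    by (subst eq) (rule integrable_edge_set[OF p finite_edges_upto sub])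
  show "(\<integral>\<omega>. g (path_config (edge_set \<omega>) n) \<partial>barak_erdos p) =
      wsum {1..Suc n} (geo_weight p (Suc n)) n (\<lambda>xs. g (ibm_run xs))"
    by (subst eq, subst expectation_edge_set[OF p finite_edges_upto sub], rule bernoulli_sum_path_config) simp
qed

section \<open>Criteria for convergence along all \<open>n\<close> and for almost sure
  convergence\<close>

text \<open>Bound the terms between consecutive squares by monotonicity.\<close>
lemma mono_tendsto_ratio_from_squares:
  fixes v :: "nat \<Rightarrow> real"
  assumes "mono v" "\<And>n. 0 \<le> v n" and lim: "(\<lambda>k. v (k\<^sup>2) / real (k\<^sup>2)) \<longlonglongrightarrow> L"
  shows "(\<lambda>n. v n / real n) \<longlonglongrightarrow> L"
proof (rule tendsto_sandwich)
  have filt: "filterlim floor_sqrt at_top at_top"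
    unfolding filterlim_at_top
  proof
    fix K
    show "eventually (\<lambda>n. K \<le> floor_sqrt n) at_top"
      using eventually_ge_at_top[of "K\<^sup>2"] by eventually_elim (simp add: le_floor_sqrt_iff)
  qed
  let ?l = "\<lambda>k. v (k\<^sup>2) / real (k\<^sup>2) * (real k / real (Suc k))\<^sup>2"
  let ?u = "\<lambda>k. v ((Suc k)\<^sup>2) / real ((Suc k)\<^sup>2) * (real (Suc k) / real k)\<^sup>2"
  have r: "(\<lambda>k. real k / real (Suc k)) \<longlonglongrightarrow> 1" "(\<lambda>k. real (Suc k) / real k) \<longlonglongrightarrow> 1"
    by real_asymp+
  have "?l \<longlonglongrightarrow> L * 1\<^sup>2" by (intro tendsto_intros lim r)
  then show "(\<lambda>n. ?l (floor_sqrt n)) \<longlonglongrightarrow> L"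
    using filterlim_compose[OF _ filt, of ?l "nhds L"] by simp
  have "?u \<longlonglongrightarrow> L * 1\<^sup>2" by (intro tendsto_intros LIMSEQ_Suc[OF lim] r)
  then show "(\<lambda>n. ?u (floor_sqrt n)) \<longlonglongrightarrow> L"
    using filterlim_compose[OF _ filt, of ?u "nhds L"] by simp
  have bounds: "(floor_sqrt n)\<^sup>2 \<le> n" "n \<le> (Suc (floor_sqrt n))\<^sup>2" "0 < floor_sqrt n" if "1 \<le> n" for n
    using Suc_floor_sqrt_power2_gt[of n] that by (auto simp del: power2_eq_square)
  show "eventually (\<lambda>n. ?l (floor_sqrt n) \<le> v n / real n) sequentially"
    using eventually_ge_at_top[of 1]
  proof eventually_elim
    case (elim n)
    define k where "k = floor_sqrt n"
    note b = bounds[OF elim, folded k_def]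
    have "?l k = v (k\<^sup>2) / real ((Suc k)\<^sup>2)"
      using b(3) by (simp add: power_divide)
    also have "\<dots> \<le> v n / real n"
      using assms(2) elim b(2) monoD[OF assms(1) b(1)] by (intro frac_le) (auto simp del: of_nat_power of_nat_Suc)
    finally show ?case by (simp only: k_def)
  qed
  show "eventually (\<lambda>n. v n / real n \<le> ?u (floor_sqrt n)) sequentially"
    using eventually_ge_at_top[of 1]
  proof eventually_elim
    case (elim n)
    define k where "k = floor_sqrt n"
    note b = bounds[OF elim, folded k_def]
    have "v n / real n \<le> v ((Suc k)\<^sup>2) / real (k\<^sup>2)"
      using assms(2) b(1,3) monoD[OF assms(1) b(2)] by (intro frac_le) (auto simp del: of_nat_power of_nat_Suc)
    also have "\<dots> = ?u k"
      using b(3) by (simp add: power_divide del: of_nat_Suc)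
    finally show ?case by (simp only: k_def)
  qed
qed

text \<open>By Tonelli the sum of the squares has finite expectation, so it is finite almost surely
  and its terms tend to 0.\<close>

lemma (in prob_space) AE_tendsto_0_of_summable_second_moment:
  fixes Z :: "nat \<Rightarrow> 'a \<Rightarrow> real"
  assumes int: "\<And>k. integrable M (\<lambda>\<omega>. (Z k \<omega>)\<^sup>2)"
    and bound: "\<And>k. expectation (\<lambda>\<omega>. (Z k \<omega>)\<^sup>2) \<le> b k" and "summable b"
  shows "AE \<omega> in M. (\<lambda>k. Z k \<omega>) \<longlonglongrightarrow> 0"
proof -
  have meas: "(\<lambda>\<omega>. ennreal ((Z k \<omega>)\<^sup>2)) \<in> borel_measurable M" for k
    using int[of k] by (intro measurable_compose[OF _ measurable_ennreal]) auto
  have b0: "0 \<le> b k" for k using bound[of k] by (rule order_trans[rotated]) simp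
  have "(\<integral>\<^sup>+\<omega>. (\<Sum>k. ennreal ((Z k \<omega>)\<^sup>2)) \<partial>M) = (\<Sum>k. \<integral>\<^sup>+\<omega>. ennreal ((Z k \<omega>)\<^sup>2) \<partial>M)"
    using meas by (rule nn_integral_suminf)
  also have "\<dots> = (\<Sum>k. ennreal (expectation (\<lambda>\<omega>. (Z k \<omega>)\<^sup>2)))"
    using int by (intro suminf_cong nn_integral_eq_integral) auto
  also have "\<dots> \<le> (\<Sum>k. ennreal (b k))"
    using bound by (intro suminf_le) (auto intro: ennreal_leI)
  also have "\<dots> < \<top>"
    using suminf_ennreal2[OF b0 assms(3)] by simp
  finally have "AE \<omega> in M. (\<Sum>k. ennreal ((Z k \<omega>)\<^sup>2)) \<noteq> \<infinity>"
    using meas by (intro nn_integral_PInf_AE) auto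
  then show ?thesis
  proof eventually_elim
    case (elim \<omega>)
    then have "summable (\<lambda>k. (Z k \<omega>)\<^sup>2)"
      by (intro summable_suminf_not_top) auto
    then have "(\<lambda>k. (Z k \<omega>)\<^sup>2) \<longlonglongrightarrow> 0" by (rule summable_LIMSEQ_zero)
    from tendsto_real_sqrt[OF this] show ?case by (simp add: tendsto_rabs_zero_iff)
  qed
qed

lemma front_path_config_mono: "mono (\<lambda>n. front (path_config E n))"
proof (rule monoI)
  fix m n :: nat assume mn: "m \<le> n"
  show "front (path_config E m) \<le> front (path_config E n)"
  proof (rule ccontr)
    assume "\<not> ?thesis"
    then have "0 < path_config E m (front (path_config E n))"
      using bin_config_pos_iff[OF bin_config_path_config] by simp
    then have "0 < path_config E n (front (path_config E n))"
      using mn unfolding path_config_pos_iff by fastforce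
    then show False using bin_config_pos_iff[OF bin_config_path_config] by blast
  qed
qed

text \<open>By the variance bound the normalised deviations at \<open>k\<^sup>2\<close> have second
  moment at most \<open>K / k\<^sup>2\<close>, which is summable; monotonicity of the front covers
  the remaining \<open>n\<close>.\<close>

lemma AE_front_path_config_limit:
  assumes p: "0 < p" "p \<le> 1" and lim: "(\<lambda>n. mean_front p n / real n) \<longlonglongrightarrow> L"
  shows "AE \<omega> in barak_erdos p. (\<lambda>n. real (front (path_config (edge_set \<omega>) n)) / real n) \<longlonglongrightarrow> L"
proof -
  interpret prob_space "barak_erdos p" by (rule prob_space_barak_erdos)
  define V where "V n \<omega> = real (front (path_config (edge_set \<omega>) n))" for n \<omega>
  obtain K where K: "0 \<le> K" "\<And>N n. 1 \<le> N \<Longrightarrow>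
      wsum {1..N} (geo_weight p N) n (\<lambda>xs. (real (front_word xs))\<^sup>2) -
      (wsum {1..N} (geo_weight p N) n (\<lambda>xs. real (front_word xs)))\<^sup>2 \<le> K * real n"
    using front_word_variance_bound[OF p] by blast
  have p': "0 \<le> p" "p \<le> 1" using p by auto
  have int: "integrable (barak_erdos p) (V n)" "integrable (barak_erdos p) (\<lambda>\<omega>. (V n \<omega>)\<^sup>2)" for n
    unfolding V_def using integrable_path_config[OF p', of "\<lambda>c. real (front c)" n]
      integrable_path_config[OF p', of "\<lambda>c. (real (front c))\<^sup>2" n] by auto
  have E1: "expectation (V n) = mean_front p n" for n
    unfolding V_def mean_front_def
    using expectation_path_config[OF p', of "\<lambda>c. real (front c)" n] by (simp only: front_word_def)
  have E2: "expectation (\<lambda>\<omega>. (V n \<omega>)\<^sup>2) = wsum {1..Suc n} (geo_weight p (Suc n)) n (\<lambda>xs. (real (front_word xs))\<^sup>2)" for n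
    unfolding V_def
    using expectation_path_config[OF p', of "\<lambda>c. (real (front c))\<^sup>2" n] by (simp only: front_word_def)
  have intc: "integrable (barak_erdos p) (\<lambda>\<omega>. (V n \<omega> - mean_front p n)\<^sup>2)" for n
    unfolding power2_diff using int by auto
  have var: "expectation (\<lambda>\<omega>. (V n \<omega> - mean_front p n)\<^sup>2) \<le> K * real n" for n
  proof -
    have "expectation (\<lambda>\<omega>. (V n \<omega> - mean_front p n)\<^sup>2) = expectation (\<lambda>\<omega>. (V n \<omega>)\<^sup>2) - (expectation (V n))\<^sup>2"
      using variance_eq[OF int(1) int(2), of n] by (simp only: E1)
    also have "\<dots> \<le> K * real n"
      using K(2)[of "Suc n" n] unfolding E1 E2 mean_front_def by simp
    finally show ?thesis .
  qed
  define Z where "Z k \<omega> = (V (k\<^sup>2) \<omega> - mean_front p (k\<^sup>2)) / real (k\<^sup>2)" for k \<omega>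
  have Z2: "(Z k \<omega>)\<^sup>2 = (V (k\<^sup>2) \<omega> - mean_front p (k\<^sup>2))\<^sup>2 / (real (k\<^sup>2))\<^sup>2" for k \<omega>
    by (simp add: Z_def power_divide)
  have "AE \<omega> in barak_erdos p. (\<lambda>k. Z k \<omega>) \<longlonglongrightarrow> 0"
  proof (rule AE_tendsto_0_of_summable_second_moment)
    show "integrable (barak_erdos p) (\<lambda>\<omega>. (Z k \<omega>)\<^sup>2)" for k
      unfolding Z2 using intc by (rule integrable_divide_zero)
    show "expectation (\<lambda>\<omega>. (Z k \<omega>)\<^sup>2) \<le> K * (1 / (real k)\<^sup>2)" for k
    \<comment> \<open>At \<open>k = 0\<close> both sides are 0, since division by 0 yields
      0.\<close>
    proof (cases "k = 0")
      case False
      have "expectation (\<lambda>\<omega>. (Z k \<omega>)\<^sup>2) \<le> K * real (k\<^sup>2) / (real (k\<^sup>2))\<^sup>2"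
        unfolding Z2 integral_divide_zero by (intro divide_right_mono var) simp
      also have "\<dots> = K * (1 / (real k)\<^sup>2)"
        using False by (simp add: power2_eq_square)
      finally show ?thesis .
    qed (simp add: Z_def)
    show "summable (\<lambda>k. K * (1 / (real k)\<^sup>2))"
      using inverse_power_summable[of 2, where 'a = real]
      by (intro summable_mult) (simp add: inverse_eq_divide)
  qed
  then show ?thesis
  proof eventually_elim
    case (elim \<omega>)
    have "filterlim (\<lambda>k::nat. k\<^sup>2) at_top at_top"
      by (rule filterlim_at_top_mono[OF filterlim_ident]) (auto simp: power2_eq_square intro!: always_eventually)
    from filterlim_compose[OF lim this]
    have "(\<lambda>k. Z k \<omega> + mean_front p (k\<^sup>2) / real (k\<^sup>2)) \<longlonglongrightarrow> 0 + L"
      using elim by (intro tendsto_add)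
    moreover have "Z k \<omega> + mean_front p (k\<^sup>2) / real (k\<^sup>2) = V (k\<^sup>2) \<omega> / real (k\<^sup>2)" for k
      by (simp add: Z_def diff_divide_distrib)
    ultimately have "(\<lambda>k. V (k\<^sup>2) \<omega> / real (k\<^sup>2)) \<longlonglongrightarrow> L" by simp
    moreover have "mono (\<lambda>n. V n \<omega>)"
      using front_path_config_mono[of "edge_set \<omega>"] by (auto simp: V_def mono_def)
    ultimately have "(\<lambda>n. V n \<omega> / real n) \<longlonglongrightarrow> L"
      by (intro mono_tendsto_ratio_from_squares) (simp_all add: V_def)
    then show ?case by (simp only: V_def)
  qed
qed

lemma mean_front_tendsto:
  fixes p :: real
  assumes "0 < p" "p \<le> 1"
  shows "\<exists>L. (\<lambda>n. mean_front p n / real n) \<longlonglongrightarrow> L"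
proof -
  obtain e f where "0 < e" "\<And>z. z \<in> ball (complex_of_real p) e \<Longrightarrow> (\<lambda>n. mean_front z n / of_nat n) \<longlonglongrightarrow> f z"
    using mean_front_tendsto_holomorphic[OF assms] by blast
  then have "(\<lambda>n. mean_front (complex_of_real p) n / of_nat n) \<longlonglongrightarrow> f (complex_of_real p)" by simp
  from tendsto_mean_front_of_real[OF this] show ?thesis ..
qed

lemma mean_front_tendsto_growth_rate:
  assumes p: "0 < p" "p \<le> 1"
  shows "(\<lambda>n. mean_front p n / real n) \<longlonglongrightarrow> growth_rate p"
proof -
  interpret prob_space "barak_erdos p" by (rule prob_space_barak_erdos)
  obtain L where L: "(\<lambda>n. mean_front p n / real n) \<longlonglongrightarrow> L"
    using mean_front_tendsto[OF p] by blast
  have AE: "AE \<omega> in barak_erdos p. (\<lambda>n. real (longest_path n \<omega>) / real n) \<longlonglongrightarrow> L"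
    using AE_front_path_config_limit[OF p L]
  proof eventually_elim
    case (elim \<omega>)
    \<comment> \<open>The offset between front and longest path vanishes after division by
      \<open>n\<close>.\<close>
    have "(\<lambda>n. 1 / real n) \<longlonglongrightarrow> 0" by real_asymp
    from tendsto_diff[OF elim this]
    have "(\<lambda>n. real (front (path_config (edge_set \<omega>) n)) / real n - 1 / real n) \<longlonglongrightarrow> L" by simp
    moreover have "eventually (\<lambda>n. real (front (path_config (edge_set \<omega>) n)) / real n - 1 / real n =
        real (longest_path n \<omega>) / real n) sequentially"
      using eventually_ge_at_top[of 1]
      by eventually_elim (simp add: front_path_config flip: diff_divide_distrib)
    ultimately show ?case by (rule Lim_transform_eventually)
  qed
  have "growth_rate p = L"
    unfolding growth_rate_def
  proof (rule the_equality)
    show "AE \<omega> in barak_erdos p. (\<lambda>n. real (longest_path n \<omega>) / real n) \<longlonglongrightarrow> L" by (rule AE)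
  next
    fix c assume "AE \<omega> in barak_erdos p. (\<lambda>n. real (longest_path n \<omega>) / real n) \<longlonglongrightarrow> c"
    with AE have "AE \<omega> in barak_erdos p. c = L"
      by eventually_elim (rule LIMSEQ_unique)
    \<comment> \<open>In a probability space an almost sure statement that does not mention the
      sample point is true outright.\<close>
    then show "c = L" by simp
  qed
  with L show ?thesis by simp
qed

theorem theorem4p5: "real_analytic_on growth_rate {0<..1}"
  by (intro mean_front_limit_analytic mean_front_tendsto_growth_rate)

end
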